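(* Let $n\ge 2$, let $M$ be a real symmetric positive definite $n\times n$ matrix, let $H(\xi)=\sqrt{\langle M\xi,\xi\rangle}$ for $\xi\in\mathbb{R}^n$, let $H^*$ be the dual norm of $H$, and let $B=\sqrt{M}$ be the unique symmetric positive definite matrix with $B^2=M$. Let $T_{H}:\mathbb{R}^{n}\setminus\{0\}\to\mathbb{R}^{n}\setminus\{0\}$ be given by $T_{H}(\xi)=\frac{\nabla H(\xi)}{H(\xi)}$, and write $\eta=Bx$. (i) Let $u\in H^1_{loc}(\mathbb{R}^n\setminus\{0\})$ and $\widehat{u}:=\frac{u\circ T_{H}}{H^{n-2}}$ in $\mathbb{R}^n\setminus\{0\}$. Then, in the weak sense, $$\Delta^{H^*}\widehat{u}(x) = \Delta_{\eta} [\widehat{u}(B^{-1}\eta)] =\frac{(\Delta^{H}u)\circ T_{H}}{H^{n+2}}(x) \quad \text{in } \mathbb{R}^n\setminus\{0\},$$ where $\Delta_\eta$ is the Laplacian with respect to the variable $\eta$. (ii) Let $u\in W^{1,n}_{loc}(\mathbb{R}^n\setminus\{0\})$ and $u^{*}:=u\circ T_{H}$ in $\mathbb{R}^n\setminus\{0\}$. Then, in the weak sense, $$\Delta_n^{H^*}u^*(x) = (\Delta_{n})_{\eta}[u^{*}(B^{-1}\eta)]=\frac{(\Delta_{n}^{H}u)\circ T_{H}}{H^{2n}}(x) \quad \text{in } \mathbb{R}^n\setminus\{0\},$$ where $(\Delta_n)_\eta$ is the classical $n$-Laplacian with respect to the variable $\eta$.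
   Context: The dual norm is $H^{*}(x)=\sup\{\langle x,\xi\rangle:\ \xi\in\mathbb{R}^n,\ H(\xi)<1\}$; for $H(\xi)=\sqrt{\langle M\xi,\xi\rangle}$ it equals $H^*(x)=\sqrt{\langle M^{-1}x,x\rangle}$. For a norm $N\in C^2(\mathbb{R}^n\setminus\{0\})$ (here $N=H$, $N=H^*$ or the Euclidean norm) and $p>1$, the Finsler $p$-Laplacian is $\Delta_{p}^{N}u=\sum_{i=1}^{n}\frac{\partial}{\partial x_{i}}\left(N^{p-1}(\nabla u)N_{\xi_{i}}(\nabla u)\right)$, where $N_{\xi_i}=\partial N/\partial\xi_i$ and the vector field $\xi\mapsto N^{p-1}(\xi)\nabla N(\xi)$ is taken to be $0$ at $\xi=0$. One writes $\Delta^N=\Delta^N_2$. For the Euclidean norm this is the classical $p$-Laplacian $\Delta_pu=\operatorname{div}(|\nabla u|^{p-2}\nabla u)$, with $\Delta=\Delta_2$. Weak sense: put $\Omega=\mathbb{R}^n\setminus\{0\}$. For $u\in W^{1,p}_{loc}(\Omega)$, $\Delta^N_pu$ is the linear functional $\phi\mapsto\langle\Delta_p^Nu,\phi\rangle:=-\int_{\Omega} N^{p-1}(\nabla u)\,\nabla N(\nabla u)\cdot\nabla\phi\,dx$ on $C^1_c(\Omega)$. For such a functional $S$, a smooth function $a$ on $\Omega$ and a smooth diffeomorphism $\Phi$ of $\Omega$ onto itself (such as $T_H$ or $x\mapsto Bx$), $aS$ and $S\circ\Phi$ are defined as for distributions: $\langle aS,\phi\rangle=\langle S,a\phi\rangle$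 and $\langle S\circ\Phi,\phi\rangle=\langle S,\,|\det D(\Phi^{-1})|\,\phi\circ\Phi^{-1}\rangle$. The displayed identities are equalities of functionals on $C_c^1(\Omega)$ in the variable $x$. The middle terms mean: take the classical Laplacian (respectively $n$-Laplacian) of the function $\eta\mapsto\widehat u(B^{-1}\eta)$ (respectively $\eta\mapsto u^*(B^{-1}\eta)$) on $\Omega$, and evaluate at $\eta=Bx$, i.e. compose with $x\mapsto Bx$. *)

theory Defs
  imports "HOL-Analysis.Analysis"
begin

section \<open>Gradients, norms and matrices\<close>

definition gradient :: "('a::real_inner \<Rightarrow> real) \<Rightarrow> 'a \<Rightarrow> 'a" where
  "gradient f x = (THE D. GDERIV f x :> D)"

lemma gradient_eqI:
  assumes "GDERIV f x :> D"
  shows "gradient f x = D"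
  unfolding gradient_def
proof (rule the_equality[where P = "\<lambda>D. GDERIV f x :> D", OF assms])
  fix E assume "GDERIV f x :> E"
  with assms have "(\<lambda>h. h \<bullet> E) = (\<lambda>h. h \<bullet> D)"
    unfolding gderiv_def by (rule has_derivative_unique[rotated])
  then show "E = D"
    by (metis vector_eq_ldot)
qed

definition sym_pos_def :: "real^'n^'n \<Rightarrow> bool" where
  "sym_pos_def M \<longleftrightarrow> transpose M = M \<and> (\<forall>x. x \<noteq> 0 \<longrightarrow> 0 < (M *v x) \<bullet> x)"

definition dual_norm :: "('a::real_inner \<Rightarrow> real) \<Rightarrow> 'a \<Rightarrow> real" where
  "dual_norm N x = (SUP \<xi>\<in>{\<xi>. N \<xi> < 1}. x \<bullet> \<xi>)"

section \<open>Test functions and local Sobolev spaces\<close>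

text \<open>Functions on an open set \<open>\<Omega>\<close> are total functions whose values outside \<open>\<Omega>\<close> are
  irrelevant; test functions are extended by zero.\<close>

definition C1c :: "('a::euclidean_space) set \<Rightarrow> ('a \<Rightarrow> real) set" where
  "C1c \<Omega> = {\<phi>. \<phi> differentiable_on \<Omega> \<and> continuous_on \<Omega> (gradient \<phi>) \<and>
                (\<exists>K. compact K \<and> K \<subseteq> \<Omega> \<and> (\<forall>x. x \<notin> K \<longrightarrow> \<phi> x = 0))}"

definition Lp_loc :: "('a::euclidean_space) set \<Rightarrow> real \<Rightarrow> ('a \<Rightarrow> 'b::euclidean_space) set" where
  "Lp_loc \<Omega> p = {f. f \<in> borel_measurable (lebesgue_on \<Omega>) \<and>
     (\<forall>K. compact K \<and> K \<subseteq> \<Omega> \<longrightarrow> set_integrable lebesgue K (\<lambda>x. norm (f x) powr p))}"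

text \<open>Testing against \<open>C\<^sup>1\<close> functions of compact support gives the same weak derivatives as
  testing against smooth ones.\<close>

definition has_weak_gradient ::
  "(real^'n) set \<Rightarrow> (real^'n \<Rightarrow> real) \<Rightarrow> (real^'n \<Rightarrow> real^'n) \<Rightarrow> bool" where
  "has_weak_gradient \<Omega> u g \<longleftrightarrow> u \<in> Lp_loc \<Omega> 1 \<and> g \<in> Lp_loc \<Omega> 1 \<and>
     (\<forall>\<phi>\<in>C1c \<Omega>. \<forall>i. (LINT x:\<Omega>|lebesgue. u x * gradient \<phi> x $ i)
                     = - (LINT x:\<Omega>|lebesgue. g x $ i * \<phi> x))"

text \<open>Weak gradients are unique only almost everywhere; the choice of representative does not
  affect the integrals below.\<close>

definition weak_gradient ::
  "(real^'n) set \<Rightarrow> (real^'n \<Rightarrow> real) \<Rightarrow> real^'n \<Rightarrow> real^'n" where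
  "weak_gradient \<Omega> u = (SOME g. has_weak_gradient \<Omega> u g)"

definition W1p_loc :: "(real^'n) set \<Rightarrow> real \<Rightarrow> (real^'n \<Rightarrow> real) set" where
  "W1p_loc \<Omega> p = {u. u \<in> Lp_loc \<Omega> p \<and> (\<exists>g. has_weak_gradient \<Omega> u g \<and> g \<in> Lp_loc \<Omega> p)}"

section \<open>Functionals on test functions\<close>

definition finsler_field ::
  "(real^'n \<Rightarrow> real) \<Rightarrow> real \<Rightarrow> real^'n \<Rightarrow> real^'n" where
  "finsler_field N p \<xi> = (if \<xi> = 0 then 0 else N \<xi> powr (p - 1) *\<^sub>R gradient N \<xi>)"

lemma finsler_field_norm: "finsler_field norm p \<xi> = norm \<xi> powr (p - 2) *\<^sub>R \<xi>"
proof (cases "\<xi> = 0")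
  case False
  then have "gradient norm \<xi> = sgn \<xi>"
    by (intro gradient_eqI GDERIV_norm)
  moreover have "norm \<xi> powr (p - 1) = norm \<xi> powr (p - 2) * norm \<xi>"
    using False powr_add[of "norm \<xi>" "p - 2" 1] by simp
  ultimately show ?thesis
    using False by (simp add: finsler_field_def sgn_div_norm)
qed (simp add: finsler_field_def)

definition finsler_laplacian ::
  "(real^'n) set \<Rightarrow> (real^'n \<Rightarrow> real) \<Rightarrow> real \<Rightarrow> (real^'n \<Rightarrow> real)
     \<Rightarrow> (real^'n \<Rightarrow> real) \<Rightarrow> real" where
  "finsler_laplacian \<Omega> N p u \<phi> =
     - (LINT x:\<Omega>|lebesgue. finsler_field N p (weak_gradient \<Omega> u x) \<bullet> gradient \<phi> x)"

definition fun_times ::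
  "('a \<Rightarrow> real) \<Rightarrow> (('a \<Rightarrow> real) \<Rightarrow> real) \<Rightarrow> ('a \<Rightarrow> real) \<Rightarrow> real" where
  "fun_times a S \<phi> = S (\<lambda>x. a x * \<phi> x)"

text \<open>The composition \<open>S \<circ> \<Phi>\<close> of a functional with a diffeomorphism \<open>\<Phi>\<close> of \<open>\<Omega>\<close> onto itself.
  The transformed test function is again extended by zero.\<close>

definition fun_comp ::
  "(real^'n) set \<Rightarrow> ((real^'n \<Rightarrow> real) \<Rightarrow> real) \<Rightarrow> (real^'n \<Rightarrow> real^'n)
     \<Rightarrow> (real^'n \<Rightarrow> real) \<Rightarrow> real" where
  "fun_comp \<Omega> S \<Phi> \<phi> =
     S (\<lambda>y. if y \<in> \<Omega> then \<bar>det (jacobian (inv_into \<Omega> \<Phi>) (at y))\<bar> * \<phi> (inv_into \<Omega> \<Phi> y) else 0)"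

definition eq_on_tests ::
  "('a::euclidean_space) set \<Rightarrow> (('a \<Rightarrow> real) \<Rightarrow> real) \<Rightarrow> (('a \<Rightarrow> real) \<Rightarrow> real) \<Rightarrow> bool" where
  "eq_on_tests \<Omega> S R \<longleftrightarrow> (\<forall>\<phi>\<in>C1c \<Omega>. S \<phi> = R \<phi>)"

end

theory Submission
  imports Defs
begin

text \<open>
  Everything is reduced to the Euclidean norm, where the statement is the conformal covariance of
  the Laplacian and of the \<open>n\<close>-Laplacian under the inversion \<open>I z = z / \<bar>z\<bar>\<^sup>2\<close>. Since
  \<open>H \<xi> = \<bar>B \<xi>\<bar>\<close>, the map \<open>T\<close> is \<open>B \<circ> I \<circ> B\<close> and the dual norm is
  \<open>x \<mapsto> \<bar>B\<^sup>-\<^sup>1 x\<bar>\<close>. With \<open>v = u \<circ> B\<close>, the function \<open>w = u_hat \<circ> B\<^sup>-\<^sup>1\<close> is the Kelvin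
  transform \<open>\<bar>\<eta>\<bar>\<^bsup>2-n\<^esup> v (I \<eta>)\<close>, and \<open>u_star \<circ> B\<^sup>-\<^sup>1\<close> is \<open>v \<circ> I\<close>. The linear change of
  variables \<open>finsler_laplacian_linear\<close> turns the Finsler Laplacian of \<open>\<bar>B \<xi>\<bar>\<close> or of
  its dual into the Euclidean one; applied with \<open>B\<close> it is the first identity of each part, and
  applied with \<open>B\<^sup>-\<^sup>1\<close> it reduces the second identity to a Euclidean one. The bookkeeping of
  Jacobians and weights, common to both parts, is \<open>kelvin_identity_transfer\<close>.

  The Euclidean identities are \<open>n_laplacian_inversion\<close> and \<open>laplacian_kelvin\<close>. The derivative of
  \<open>I\<close> is \<open>\<bar>x\<bar>\<^sup>-\<^sup>2\<close> times a reflection, so \<open>\<bar>\<nabla>(v \<circ> I)\<bar>\<^bsup>n-2\<^esup> \<nabla>(v \<circ> I) \<bullet> \<nabla>\<phi>\<close>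
  scales by \<open>\<bar>x\<bar>\<^bsup>-2n\<^esup>\<close>, which is the Jacobian of \<open>I\<close>: this settles the \<open>n\<close>-Laplacian.
  For the Laplacian the weight \<open>k = \<bar>x\<bar>\<^bsup>2-n\<^esup>\<close> corrects the scaling, and the terms in which
  \<open>k\<close> is differentiated cancel because \<open>k\<close> is harmonic.

  These computations need a chain rule for weak gradients. Instead of approximating by smooth
  functions, it is proved by duality (\<open>has_weak_gradient_compose\<close>): the change of variables moves
  the diffeomorphism onto the test function, and because the adjugate of its derivative has
  divergence-free columns, the result is again the divergence of a field of test functions. That \<open>weak_gradient\<close> agrees almost everywhere
  with the gradients computed in this way is the fundamental lemma of the calculus of variations.
\<close>

section \<open>Change of variables over an arbitrary finite index type\<close>

text \<open>The theorem \<open>has_absolute_integral_change_of_variables\<close> is stated for a well-ordered index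
  type. A finite type carries no canonical order, but it has the same cardinality as an initial
  segment of the natural numbers, and renaming coordinates along a bijection changes neither
  Lebesgue measure nor determinants.\<close>
typedef 'a idx = "{..<CARD('a::finite)}"
  by (auto intro!: exI[of _ 0])

instantiation idx :: (finite) linorder
begin
definition less_eq_idx :: "'a idx \<Rightarrow> 'a idx \<Rightarrow> bool" where
  "less_eq_idx a b \<longleftrightarrow> Rep_idx a \<le> Rep_idx b"
definition less_idx :: "'a idx \<Rightarrow> 'a idx \<Rightarrow> bool" where
  "less_idx a b \<longleftrightarrow> Rep_idx a < Rep_idx b"
instance
  by standard (auto simp: less_eq_idx_def less_idx_def Rep_idx_inject)
end

instance idx :: (finite) finite
proof
  have "finite (range (Rep_idx :: 'a idx \<Rightarrow> nat))"
    by (rule finite_subset[of _ "{..<CARD('a)}"]) (use Rep_idx in auto)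
  then show "finite (UNIV :: 'a idx set)"
    by (rule finite_imageD) (simp add: inj_on_def Rep_idx_inject)
qed

instance idx :: (finite) wellorder
proof
  fix P :: "'a idx \<Rightarrow> bool" and a
  assume step: "\<And>x. (\<And>y. y < x \<Longrightarrow> P y) \<Longrightarrow> P x"
  show "P a"
  proof (induction a rule: measure_induct_rule[where f = Rep_idx])
    case (less x)
    show ?case
      by (rule step, rule less) (simp add: less_idx_def)
  qed
qed

lemma ex_bij_idx: "\<exists>\<pi> :: 'n::finite idx \<Rightarrow> 'n. bij \<pi>"
proof -
  have "CARD('n idx) = CARD('n)"
    using type_definition.card[OF type_definition_idx[where 'a = 'n]] by simp
  then show ?thesis
    using finite_same_card_bij[of "UNIV :: 'n idx set" "UNIV :: 'n set"] by auto
qed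

definition reindex :: "('k \<Rightarrow> 'n) \<Rightarrow> real^'n \<Rightarrow> real^'k" where
  "reindex \<pi> x = (\<chi> k. x $ \<pi> k)"

lemma reindex_nth [simp]: "reindex \<pi> x $ k = x $ \<pi> k"
  by (simp add: reindex_def)

lemma linear_reindex: "linear (reindex (\<pi> :: 'k::finite \<Rightarrow> 'n::finite))"
  by (rule linearI) (simp_all add: vec_eq_iff)

lemma reindex_inv [simp]:
  assumes "bij \<pi>"
  shows "reindex (inv \<pi>) (reindex \<pi> x) = x" "reindex \<pi> (reindex (inv \<pi>) y) = y"
  using assms by (simp_all add: vec_eq_iff bij_is_surj bij_is_inj surj_f_inv_f)

lemma inj_reindex: "bij \<pi> \<Longrightarrow> inj (reindex \<pi>)"
  by (metis injI reindex_inv(1))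

lemma borel_measurable_reindex: "reindex (\<pi> :: 'k::finite \<Rightarrow> 'n::finite) \<in> borel_measurable borel"
  by (intro borel_measurable_continuous_onI linear_continuous_on)
    (simp add: linear_reindex flip: linear_conv_bounded_linear)

lemma lborel_reindex:
  fixes \<pi> :: "'k::finite \<Rightarrow> 'n::finite"
  assumes \<pi>: "bij \<pi>"
  shows "distr lborel borel (reindex \<pi>) = lborel"
proof (rule lborel_eqI[symmetric])
  note [measurable] = borel_measurable_reindex[of \<pi>]
  fix l u :: "real^'k"
  assume le: "\<And>b. b \<in> Basis \<Longrightarrow> l \<bullet> b \<le> u \<bullet> b"
  then have le': "l $ i \<le> u $ i" for i
    by (metis cart_eq_inner_axis axis_in_Basis_iff Basis_real_def singletonI)
  have preimage: "reindex \<pi> -` box l u = box (reindex (inv \<pi>) l) (reindex (inv \<pi>) u)"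
    using \<pi> by (auto simp: mem_box_cart) (metis bij_inv_eq_iff)+
  have "emeasure (distr lborel borel (reindex \<pi>)) (box l u)
      = emeasure lborel (box (reindex (inv \<pi>) l) (reindex (inv \<pi>) u))"
    by (simp add: emeasure_distr preimage)
  also have "\<dots> = ennreal (measure lborel (cbox (reindex (inv \<pi>) l) (reindex (inv \<pi>) u)))"
    by (simp add: emeasure_lborel_box_eq content_cbox_if_cart emeasure_lborel_cbox_eq measure_def)
  also have "measure lborel (cbox (reindex (inv \<pi>) l) (reindex (inv \<pi>) u)) = (\<Prod>i\<in>UNIV. (u - l) $ inv \<pi> i)"
    using le' by (subst content_cbox_cart) (auto simp: box_ne_empty cart_eq_inner_axis[symmetric] Basis_vec_def)
  also have "\<dots> = (\<Prod>k\<in>UNIV. (u - l) $ k)"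
    using prod.reindex_bij_betw[of "inv \<pi>" UNIV UNIV "\<lambda>k. (u - l) $ k"] \<pi> bij_imp_bij_inv by blast
  also have "\<dots> = (\<Prod>b\<in>Basis. (u - l) \<bullet> b)"
    by (simp add: Basis_vec_def cart_eq_inner_axis axis_eq_axis prod.UNION_disjoint)
  finally show "emeasure (distr lborel borel (reindex \<pi>)) (box l u) = (\<Prod>b\<in>Basis. (u - l) \<bullet> b)" .
qed simp

lemma
  fixes \<pi> :: "'k::finite \<Rightarrow> 'n::finite"
  assumes \<pi>: "bij \<pi>"
  shows measurable_reindex: "reindex \<pi> \<in> lebesgue \<rightarrow>\<^sub>M lebesgue"
    and lebesgue_reindex: "distr lebesgue lebesgue (reindex \<pi>) = lebesgue"
proof -
  note [measurable] = borel_measurable_reindex[of \<pi>]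
  have eq: "distr lebesgue lborel (reindex \<pi>) = lborel"
    using lborel_reindex[OF \<pi>] by (simp add: distr_completion cong: distr_cong)
  show "reindex \<pi> \<in> lebesgue \<rightarrow>\<^sub>M lebesgue"
    by (simp add: completion.measurable_completion2 eq measurable_completion)
  have "completion (distr lebesgue lborel (reindex \<pi>)) = distr lebesgue lebesgue (reindex \<pi>)"
    by (subst completion.completion_distr_eq) (auto simp: eq measurable_completion)
  then show "distr lebesgue lebesgue (reindex \<pi>) = lebesgue"
    by (simp add: eq)
qed

lemma
  fixes f :: "real^'k \<Rightarrow> real" and \<pi> :: "'k::finite \<Rightarrow> 'n::finite"
  assumes \<pi>: "bij \<pi>"
  shows integrable_reindex: "integrable lebesgue (\<lambda>x. f (reindex \<pi> x)) \<longleftrightarrow> integrable lebesgue f"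
    and integral_reindex: "integral\<^sup>L lebesgue (\<lambda>x. f (reindex \<pi> x)) = integral\<^sup>L lebesgue f"
proof -
  have meas: "f \<in> borel_measurable lebesgue"
    if "(\<lambda>x. f (reindex \<pi> x)) \<in> borel_measurable lebesgue"
    using measurable_comp[OF measurable_reindex that, of "inv \<pi>"] \<pi> by (simp add: o_def bij_imp_bij_inv)
  show iff: "integrable lebesgue (\<lambda>x. f (reindex \<pi> x)) \<longleftrightarrow> integrable lebesgue f"
  proof
    assume L: "integrable lebesgue (\<lambda>x. f (reindex \<pi> x))"
    then have "integrable (distr lebesgue lebesgue (reindex \<pi>)) f"
      by (subst integrable_distr_eq) (auto intro: meas measurable_reindex[OF \<pi>])
    then show "integrable lebesgue f"
      by (simp add: lebesgue_reindex[OF \<pi>])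
  next
    assume "integrable lebesgue f"
    then show "integrable lebesgue (\<lambda>x. f (reindex \<pi> x))"
      using integrable_distr[OF measurable_reindex[OF \<pi>], of f] by (simp add: lebesgue_reindex[OF \<pi>])
  qed
  show "integral\<^sup>L lebesgue (\<lambda>x. f (reindex \<pi> x)) = integral\<^sup>L lebesgue f"
  proof (cases "integrable lebesgue f")
    case True
    then show ?thesis
      using integral_distr[OF measurable_reindex[OF \<pi>], of f] by (simp add: lebesgue_reindex[OF \<pi>])
  next
    case False
    then show ?thesis
      by (simp add: iff not_integrable_integral_eq)
  qed
qed

lemma
  fixes f :: "real^'k \<Rightarrow> real" and \<pi> :: "'k::finite \<Rightarrow> 'n::finite"
  assumes \<pi>: "bij \<pi>"
  shows set_integrable_reindex:
      "set_integrable lebesgue (reindex \<pi> ` S) f \<longleftrightarrow> set_integrable lebesgue S (\<lambda>x. f (reindex \<pi> x))"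
    and set_integral_reindex:
      "(LINT y:reindex \<pi> ` S|lebesgue. f y) = (LINT x:S|lebesgue. f (reindex \<pi> x))"
proof -
  have "indicator (reindex \<pi> ` S) (reindex \<pi> x) = (indicator S x :: real)" for x
    using inj_reindex[OF \<pi>] by (auto simp: indicator_def inj_eq)
  then show
      "set_integrable lebesgue (reindex \<pi> ` S) f \<longleftrightarrow> set_integrable lebesgue S (\<lambda>x. f (reindex \<pi> x))"
      "(LINT y:reindex \<pi> ` S|lebesgue. f y) = (LINT x:S|lebesgue. f (reindex \<pi> x))"
    using integrable_reindex[OF \<pi>, of "\<lambda>y. indicator (reindex \<pi> ` S) y *\<^sub>R f y"]
      integral_reindex[OF \<pi>, of "\<lambda>y. indicator (reindex \<pi> ` S) y *\<^sub>R f y"]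
    by (simp_all add: set_integrable_def set_lebesgue_integral_def)
qed

lemma det_reindex:
  fixes A :: "real^'n^'n" and \<pi> :: "'k::finite \<Rightarrow> 'n::finite"
  assumes \<pi>: "bij \<pi>"
  shows "det (\<chi> k l. A $ \<pi> k $ \<pi> l) = det A"
proof -
  have inv: "bij (inv \<pi>)" "inj \<pi>" "inj (inv \<pi>)"
    using \<pi> by (auto simp: bij_imp_bij_inv bij_is_inj)
  have "det A = (\<Sum>p | p permutes (UNIV :: 'k set). of_int (sign p) * (\<Prod>k\<in>UNIV. A $ \<pi> k $ \<pi> (p k)))"
    unfolding det_def
  proof (rule sum.reindex_bij_witness[where i = "map_permutation UNIV \<pi>" and j = "map_permutation UNIV (inv \<pi>)"])
    fix p assume "p \<in> {p. p permutes (UNIV :: 'n set)}"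
    then have p: "p permutes UNIV" by simp
    show 1: "map_permutation UNIV \<pi> (map_permutation UNIV (inv \<pi>) p) = p"
      using p inv \<pi> by (intro map_permutation_compose_inv[of _ _ UNIV]) (auto simp: bij_is_surj surj_f_inv_f)
    show "map_permutation UNIV (inv \<pi>) p \<in> {p. p permutes UNIV}"
      using p inv by (auto intro!: map_permutation_permutes)
    have app: "\<pi> (map_permutation UNIV (inv \<pi>) p k) = p (\<pi> k)" for k
      using map_permutation_apply[OF inv(3), of "\<pi> k" p] \<pi> inv
      by (simp add: bij_is_surj surj_f_inv_f)
    have "(\<Prod>k\<in>UNIV. A $ \<pi> k $ p (\<pi> k)) = (\<Prod>i\<in>UNIV. A $ i $ p i)"
      using prod.reindex_bij_betw[of \<pi> UNIV UNIV "\<lambda>i. A $ i $ p i"] \<pi> by simp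
    then show "of_int (sign (map_permutation UNIV (inv \<pi>) p))
        * (\<Prod>k\<in>UNIV. A $ \<pi> k $ \<pi> (map_permutation UNIV (inv \<pi>) p k))
        = of_int (sign p) * (\<Prod>i\<in>UNIV. A $ i $ p i)"
      using sign_map_permutation[OF inv(3) p] by (simp add: app)
  next
    fix q assume "q \<in> {q. q permutes (UNIV :: 'k set)}"
    then have q: "q permutes UNIV" by simp
    show "map_permutation UNIV (inv \<pi>) (map_permutation UNIV \<pi> q) = q"
      using q inv \<pi> by (intro map_permutation_compose_inv[of _ _ UNIV]) auto
    show "map_permutation UNIV \<pi> q \<in> {p. p permutes UNIV}"
      using q \<pi> by (auto intro!: map_permutation_permutes)
  qed
  then show ?thesis
    by (simp add: det_def)
qed

lemma vec1_integrable_iff: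
  fixes f :: "'a::euclidean_space \<Rightarrow> real"
  shows "set_integrable lebesgue S (\<lambda>x. vec (f x) :: real^1) \<longleftrightarrow> set_integrable lebesgue S f"
  by (simp add: absolutely_integrable_on_1_iff)

text \<open>If one side of the integral equation is not integrable then neither is the other, and both
  integrals are zero by convention.\<close>
theorem
  fixes f :: "real^'n::finite \<Rightarrow> real" and g :: "real^'n \<Rightarrow> real^'n"
  assumes S: "S \<in> sets lebesgue"
    and der: "\<And>x. x \<in> S \<Longrightarrow> (g has_derivative g' x) (at x within S)"
    and inj: "inj_on g S"
  shows set_integrable_change_of_variables:
      "set_integrable lebesgue (g ` S) f
        \<longleftrightarrow> set_integrable lebesgue S (\<lambda>x. \<bar>det (matrix (g' x))\<bar> * f (g x))"
    and set_integral_change_of_variables: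
      "(LINT y:g ` S|lebesgue. f y) = (LINT x:S|lebesgue. \<bar>det (matrix (g' x))\<bar> * f (g x))"
proof -
  obtain \<pi> :: "'n idx \<Rightarrow> 'n" where \<pi>: "bij \<pi>"
    using ex_bij_idx by blast
  define e where "e = reindex \<pi>"
  define e' where "e' = reindex (inv \<pi>)"
  have ee' [simp]: "e (e' y) = y" "e' (e x) = x" for x y
    using \<pi> by (simp_all add: e_def e'_def)
  have lin: "linear e" "linear e'"
    by (simp_all add: e_def e'_def linear_reindex)
  have bl: "bounded_linear e" "bounded_linear e'"
    using lin linear_conv_bounded_linear by blast+
  define G where "G = (\<lambda>y. e (g (e' y)))"
  define G' where "G' = (\<lambda>y h. e (g' (e' y) (e' h)))"
  have S': "e ` S \<in> sets lebesgue"
    by (rule differentiable_image_in_sets_lebesgue[OF S])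
      (auto intro!: linear_imp_differentiable_on lin simp: type_definition.card[OF type_definition_idx])
  have derG: "(G has_derivative G' y) (at y within e ` S)" if "y \<in> e ` S" for y
  proof -
    have "(e' has_derivative e') (at y within e ` S)"
      by (rule bounded_linear_imp_has_derivative[OF bl(2)])
    moreover have "(g has_derivative g' (e' y)) (at (e' y) within e' ` e ` S)"
      using der[of "e' y"] that by (auto simp: image_image)
    ultimately have "((\<lambda>y. g (e' y)) has_derivative (\<lambda>h. g' (e' y) (e' h))) (at y within e ` S)"
      using diff_chain_within[of e' e' y "e ` S" g "g' (e' y)"] by (simp add: o_def)
    then show ?thesis
      unfolding G_def G'_def by (rule bounded_linear.has_derivative[OF bl(1)])
  qed
  have injG: "inj_on G (e ` S)"
    using inj by (auto simp: inj_on_def G_def) (metis ee'(2))+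
  have GS: "G ` e ` S = e ` g ` S"
    by (simp add: image_image G_def)
  have det: "det (matrix (G' (e x))) = det (matrix (g' x))" if "x \<in> S" for x
  proof -
    have ax: "e' (axis l 1) = axis (\<pi> l) 1" for l
      using \<pi> by (auto simp: vec_eq_iff e'_def axis_def bij_is_surj surj_f_inv_f inv_f_f bij_is_inj)
    have "matrix (G' (e x)) = (\<chi> k l. matrix (g' x) $ \<pi> k $ \<pi> l)"
      by (simp add: matrix_def G'_def ax vec_eq_iff) (simp add: e_def)
    then show ?thesis
      using det_reindex[OF \<pi>, of "matrix (g' x)"] by simp
  qed
  let ?F = "\<lambda>y. vec (f (e' y)) :: real^1"
  let ?J = "\<lambda>x. \<bar>det (matrix (g' x))\<bar> * f (g x)"
  have J: "\<bar>det (matrix (G' y))\<bar> *\<^sub>R ?F (G y) = vec (?J (e' y))" if "y \<in> e ` S" for y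
    using det that by (auto simp: vec_eq_iff G_def)
  have L: "?F absolutely_integrable_on (G ` e ` S) \<longleftrightarrow> set_integrable lebesgue (g ` S) f"
    unfolding GS vec1_integrable_iff using set_integrable_reindex[OF \<pi>, of "g ` S" "\<lambda>y. f (e' y)"]
    by (simp flip: e_def)
  have "(\<lambda>y. \<bar>det (matrix (G' y))\<bar> *\<^sub>R ?F (G y)) absolutely_integrable_on (e ` S)
      \<longleftrightarrow> set_integrable lebesgue (e ` S) (\<lambda>y. vec (?J (e' y)) :: real^1)"
    by (intro set_integrable_cong) (auto simp: J)
  also have "\<dots> \<longleftrightarrow> set_integrable lebesgue S ?J"
    unfolding vec1_integrable_iff using set_integrable_reindex[OF \<pi>, of S "\<lambda>y. ?J (e' y)"]
    by (simp flip: e_def)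
  finally have R: "(\<lambda>y. \<bar>det (matrix (G' y))\<bar> *\<^sub>R ?F (G y)) absolutely_integrable_on (e ` S)
      \<longleftrightarrow> set_integrable lebesgue S ?J" .
  note cov = has_absolute_integral_change_of_variables[OF S' derG injG, of ?F]
  show iff: "set_integrable lebesgue (g ` S) f \<longleftrightarrow> set_integrable lebesgue S ?J"
    using cov L R by blast
  show "(LINT y:g ` S|lebesgue. f y) = (LINT x:S|lebesgue. ?J x)"
  proof (cases "set_integrable lebesgue S ?J")
    case True
    have "integral (e ` S) (\<lambda>y. \<bar>det (matrix (G' y))\<bar> *\<^sub>R ?F (G y)) = integral (G ` e ` S) ?F"
      using cov True R by blast
    moreover have "integral (e ` S) (\<lambda>y. \<bar>det (matrix (G' y))\<bar> *\<^sub>R ?F (G y))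
        = integral (e ` S) (\<lambda>y. vec (?J (e' y)))"
      by (intro integral_cong J)
    ultimately have "integral (e ` S) (\<lambda>y. vec (?J (e' y)) :: real^1) $ 1 = integral (G ` e ` S) ?F $ 1"
      by simp
    then have "integral (e ` S) (\<lambda>y. ?J (e' y)) = integral (e ` g ` S) (\<lambda>y. f (e' y))"
      by (simp add: integral_on_1_eq GS)
    moreover have "integral (e ` S) (\<lambda>y. ?J (e' y)) = (LINT x:S|lebesgue. ?J x)"
    proof -
      have "set_integrable lebesgue (e ` S) (\<lambda>y. ?J (e' y))"
        using set_integrable_reindex[OF \<pi>, of S "\<lambda>y. ?J (e' y)"] True by (simp flip: e_def)
      then show ?thesis
        using set_integral_reindex[OF \<pi>, of S "\<lambda>y. ?J (e' y)"]
        by (simp add: set_lebesgue_integral_eq_integral(2) flip: e_def)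
    qed
    moreover have "integral (e ` g ` S) (\<lambda>y. f (e' y)) = (LINT x:g ` S|lebesgue. f x)"
    proof -
      have "set_integrable lebesgue (e ` g ` S) (\<lambda>y. f (e' y))"
        using set_integrable_reindex[OF \<pi>, of "g ` S" "\<lambda>y. f (e' y)"] True iff by (simp flip: e_def)
      then show ?thesis
        using set_integral_reindex[OF \<pi>, of "g ` S" "\<lambda>y. f (e' y)"]
        by (simp add: set_lebesgue_integral_eq_integral(2) flip: e_def)
    qed
    ultimately show ?thesis by simp
  next
    case False
    with iff show ?thesis
      by (simp add: set_lebesgue_integral_def set_integrable_def not_integrable_integral_eq)
  qed
qed

section \<open>Continuously differentiable functions\<close>

definition C1_on :: "('a::euclidean_space) set \<Rightarrow> ('a \<Rightarrow> real) set" where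
  "C1_on \<Omega> = {f. (\<forall>x\<in>\<Omega>. GDERIV f x :> gradient f x) \<and> continuous_on \<Omega> (gradient f)}"

lemma C1_onI:
  assumes "\<And>x. x \<in> \<Omega> \<Longrightarrow> GDERIV f x :> G x" and "continuous_on \<Omega> G"
  shows "f \<in> C1_on \<Omega>"
proof -
  have "gradient f x = G x" if "x \<in> \<Omega>" for x
    using assms(1)[OF that] by (rule gradient_eqI)
  then show ?thesis
    using assms continuous_on_cong[of \<Omega> \<Omega> "gradient f" G] by (simp add: C1_on_def)
qed

lemma C1_onD: "f \<in> C1_on \<Omega> \<Longrightarrow> x \<in> \<Omega> \<Longrightarrow> GDERIV f x :> gradient f x"
  by (simp add: C1_on_def)

lemma C1_on_gradient: "f \<in> C1_on \<Omega> \<Longrightarrow> continuous_on \<Omega> (gradient f)"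
  by (simp add: C1_on_def)

lemma GDERIV_imp_isCont: "GDERIV f x :> D \<Longrightarrow> isCont f x"
  unfolding gderiv_def by (rule has_derivative_continuous)

lemma C1_on_continuous: "f \<in> C1_on \<Omega> \<Longrightarrow> continuous_on \<Omega> f"
  by (intro continuous_at_imp_continuous_on ballI) (rule GDERIV_imp_isCont, rule C1_onD)

lemma C1_on_const: "(\<lambda>x. c) \<in> C1_on \<Omega>"
  by (rule C1_onI[where G = "\<lambda>_. 0"]) (simp_all add: GDERIV_const)

lemma C1_on_inner: "(\<lambda>x. x \<bullet> v) \<in> C1_on \<Omega>"
  by (rule C1_onI[where G = "\<lambda>_. v"])
    (auto simp: gderiv_def intro!: derivative_eq_intros)

lemma C1_on_add: "f \<in> C1_on \<Omega> \<Longrightarrow> g \<in> C1_on \<Omega> \<Longrightarrow> (\<lambda>x. f x + g x) \<in> C1_on \<Omega>"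
  by (rule C1_onI[where G = "\<lambda>x. gradient f x + gradient g x"])
    (auto intro!: GDERIV_add C1_onD continuous_intros C1_on_gradient)

lemma C1_on_mult:
  "f \<in> C1_on \<Omega> \<Longrightarrow> g \<in> C1_on \<Omega> \<Longrightarrow> (\<lambda>x. f x * g x) \<in> C1_on \<Omega>"
  by (rule C1_onI[where G = "\<lambda>x. f x *\<^sub>R gradient g x + g x *\<^sub>R gradient f x"])
    (auto intro!: GDERIV_mult C1_onD continuous_intros C1_on_gradient C1_on_continuous)

lemma gradient_mult:
  "f \<in> C1_on \<Omega> \<Longrightarrow> g \<in> C1_on \<Omega> \<Longrightarrow> x \<in> \<Omega> \<Longrightarrow>
    gradient (\<lambda>x. f x * g x) x = f x *\<^sub>R gradient g x + g x *\<^sub>R gradient f x"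
  by (intro gradient_eqI GDERIV_mult C1_onD)

lemma C1_on_inverse:
  assumes f: "f \<in> C1_on \<Omega>" and nz: "\<And>x. x \<in> \<Omega> \<Longrightarrow> f x \<noteq> 0"
  shows "(\<lambda>x. inverse (f x)) \<in> C1_on \<Omega>"
proof (rule C1_onI)
  show "GDERIV (\<lambda>x. inverse (f x)) x :> - (inverse (f x))\<^sup>2 *\<^sub>R gradient f x" if "x \<in> \<Omega>" for x
    using f nz that by (intro GDERIV_inverse C1_onD)
  show "continuous_on \<Omega> (\<lambda>x. - (inverse (f x))\<^sup>2 *\<^sub>R gradient f x)"
    using nz by (intro continuous_intros C1_on_gradient[OF f] C1_on_continuous[OF f]) auto
qed

lemma C1_on_compose_real:
  assumes f: "f \<in> C1_on \<Omega>" and \<theta>: "\<And>x. x \<in> \<Omega> \<Longrightarrow> DERIV \<theta> (f x) :> \<theta>' (f x)"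
    and cont: "continuous_on \<Omega> (\<lambda>x. \<theta>' (f x))"
  shows "(\<lambda>x. \<theta> (f x)) \<in> C1_on \<Omega>"
proof (rule C1_onI)
  show "GDERIV (\<lambda>x. \<theta> (f x)) x :> \<theta>' (f x) *\<^sub>R gradient f x" if "x \<in> \<Omega>" for x
    using C1_onD[OF f that] \<theta>[OF that] by (rule GDERIV_DERIV_compose)
  show "continuous_on \<Omega> (\<lambda>x. \<theta>' (f x) *\<^sub>R gradient f x)"
    by (intro continuous_intros C1_on_gradient[OF f] cont)
qed

lemma C1_on_prod:
  "finite I \<Longrightarrow> (\<And>i. i \<in> I \<Longrightarrow> f i \<in> C1_on \<Omega>) \<Longrightarrow> (\<lambda>x. \<Prod>i\<in>I. f i x) \<in> C1_on \<Omega>"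
  by (induction I rule: finite_induct) (auto intro: C1_on_const C1_on_mult)

text \<open>The square of the positive part is the simplest \<open>C\<^sup>1\<close> function that is positive exactly
  on a half-line; products of such functions cut out boxes.\<close>
lemma DERIV_max0_square: "DERIV (\<lambda>t::real. (max 0 t)\<^sup>2) t :> 2 * max 0 t"
proof -
  consider "t < 0" | "t = 0" | "t > 0" by linarith
  then show ?thesis
  proof cases
    case 1
    have "DERIV (\<lambda>t::real. 0) t :> 0" by simp
    then have "DERIV (\<lambda>t::real. (max 0 t)\<^sup>2) t :> 0"
      by (rule has_field_derivative_transform_within_open[where S = "{..<0}"]) (use 1 in auto)
    then show ?thesis using 1 by simp
  next
    case 2
    have "((\<lambda>h::real. (max 0 h)\<^sup>2 / h) \<longlongrightarrow> 0) (at 0)"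
    proof (rule Lim_null_comparison)
      show "\<forall>\<^sub>F h in at 0. norm ((max 0 h)\<^sup>2 / h) \<le> \<bar>h::real\<bar>"
        by (auto simp: max_def power2_eq_square)
      show "((\<lambda>h::real. \<bar>h\<bar>) \<longlongrightarrow> 0) (at 0)"
        using tendsto_rabs[OF tendsto_ident_at, of "0::real" UNIV] by simp
    qed
    then show ?thesis using 2 by (simp add: DERIV_def)
  next
    case 3
    have "DERIV (\<lambda>t::real. t\<^sup>2) t :> 2 * t" by (auto intro!: derivative_eq_intros)
    then have "DERIV (\<lambda>t::real. (max 0 t)\<^sup>2) t :> 2 * t"
      by (rule has_field_derivative_transform_within_open[where S = "{0<..}"]) (use 3 in auto)
    then show ?thesis using 3 by simp
  qed
qed

section \<open>Test functions\<close>

lemma C1cI: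
  assumes "open \<Omega>" and \<phi>: "\<phi> \<in> C1_on \<Omega>" and K: "compact K" "K \<subseteq> \<Omega>" "\<And>x. x \<notin> K \<Longrightarrow> \<phi> x = 0"
  shows "\<phi> \<in> C1c \<Omega>"
proof -
  have "\<phi> differentiable (at x within \<Omega>)" if "x \<in> \<Omega>" for x
    using C1_onD[OF \<phi> that] unfolding gderiv_def
    by (meson differentiableI differentiable_at_withinI)
  then show ?thesis
    using K C1_on_gradient[OF \<phi>] unfolding C1c_def differentiable_on_def by blast
qed

text \<open>The gradient vanishes off the same compact set \<open>K\<close>, since the complement of \<open>K\<close> is open.
  In particular a test function on \<open>\<Omega>\<close> may be treated as zero near the boundary of
  \<open>\<Omega>\<close>.\<close>
lemma C1c_support:
  assumes "\<phi> \<in> C1c \<Omega>"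
  obtains K where "compact K" "K \<subseteq> \<Omega>" "\<And>x. x \<notin> K \<Longrightarrow> \<phi> x = 0" "\<And>x. x \<notin> K \<Longrightarrow> gradient \<phi> x = 0"
proof -
  obtain K where K: "compact K" "K \<subseteq> \<Omega>" "\<And>x. x \<notin> K \<Longrightarrow> \<phi> x = 0"
    using assms unfolding C1c_def by blast
  have "gradient \<phi> x = 0" if "x \<notin> K" for x
  proof -
    have "((\<lambda>_. 0) has_derivative (\<lambda>h. h \<bullet> 0)) (at x)" by simp
    then have "(\<phi> has_derivative (\<lambda>h. h \<bullet> 0)) (at x)"
      by (rule has_derivative_transform_within_open[where s = "- K"])
        (use K that in \<open>auto simp: compact_imp_closed open_Compl\<close>)
    then show ?thesis
      by (intro gradient_eqI) (simp add: gderiv_def)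
  qed
  with K that show ?thesis by blast
qed

lemma C1c_imp_C1_on:
  assumes "open \<Omega>" "\<phi> \<in> C1c \<Omega>"
  shows "\<phi> \<in> C1_on \<Omega>"
proof -
  have "GDERIV \<phi> x :> gradient \<phi> x" if "x \<in> \<Omega>" for x
  proof -
    have "\<phi> differentiable at x"
      using assms that by (simp add: C1c_def differentiable_on_eq_differentiable_at)
    then obtain D where D: "(\<phi> has_derivative D) (at x)" and lin: "linear D"
      using has_derivative_linear unfolding differentiable_def by blast
    have "D = (\<lambda>h. h \<bullet> adjoint D 1)"
      using adjoint_works[OF lin, of _ 1] by (intro ext) simp
    with D have "GDERIV \<phi> x :> adjoint D 1"
      by (simp add: gderiv_def)
    then show ?thesis
      by (simp add: gradient_eqI)
  qed
  then show ?thesis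
    using assms(2) by (simp add: C1_on_def C1c_def)
qed

lemma C1c_mult:
  assumes "open \<Omega>" "a \<in> C1_on \<Omega>" "\<phi> \<in> C1c \<Omega>"
  shows "(\<lambda>x. a x * \<phi> x) \<in> C1c \<Omega>"
proof -
  obtain K where K: "compact K" "K \<subseteq> \<Omega>" "\<And>x. x \<notin> K \<Longrightarrow> \<phi> x = 0"
    using C1c_support[OF assms(3)] by metis
  show ?thesis
    by (rule C1cI[OF assms(1) _ K(1,2)])
      (use K C1_on_mult[OF assms(2) C1c_imp_C1_on] assms in auto)
qed

section \<open>Local integrability\<close>

lemma compact_imp_sets_lebesgue: "compact S \<Longrightarrow> S \<in> sets lebesgue"
  by (simp add: borel_compact)

lemma Lp_loc_measurable: "f \<in> Lp_loc \<Omega> p \<Longrightarrow> f \<in> borel_measurable (lebesgue_on \<Omega>)"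
  by (simp add: Lp_loc_def)

lemma Lp_loc_integrable:
  "f \<in> Lp_loc \<Omega> p \<Longrightarrow> compact K \<Longrightarrow> K \<subseteq> \<Omega> \<Longrightarrow> set_integrable lebesgue K (\<lambda>x. norm (f x) powr p)"
  by (simp add: Lp_loc_def)

lemma measurable_lebesgue_on_subset:
  "f \<in> borel_measurable (lebesgue_on \<Omega>) \<Longrightarrow> K \<subseteq> \<Omega> \<Longrightarrow> f \<in> borel_measurable (lebesgue_on K)"
  by (rule measurable_restrict_mono)

lemma set_integrable_dominated:
  fixes f :: "'a::euclidean_space \<Rightarrow> 'b::euclidean_space" and g :: "'a \<Rightarrow> real"
  assumes "set_integrable lebesgue S g" "S \<in> sets lebesgue" "f \<in> borel_measurable (lebesgue_on S)"
    and "\<And>x. x \<in> S \<Longrightarrow> norm (f x) \<le> g x"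
  shows "set_integrable lebesgue S f"
  using measurable_bounded_by_integrable_imp_absolutely_integrable[OF assms(3,2)
      set_lebesgue_integral_eq_integral(1)[OF assms(1)] assms(4)] .

lemma borel_measurable_norm_powr:
  fixes f :: "'a \<Rightarrow> 'b::{second_countable_topology, real_normed_vector}"
  shows "f \<in> borel_measurable M \<Longrightarrow> (\<lambda>x. norm (f x) powr p) \<in> borel_measurable M"
  by measurable

lemma Lp_loc_dominated:
  fixes f :: "'a::euclidean_space \<Rightarrow> 'b::euclidean_space" and g :: "'a \<Rightarrow> 'c::euclidean_space"
  assumes f: "f \<in> Lp_loc \<Omega> p" and p: "0 \<le> p"
    and g: "g \<in> borel_measurable (lebesgue_on \<Omega>)"
    and dom: "\<And>K. compact K \<Longrightarrow> K \<subseteq> \<Omega> \<Longrightarrow> \<exists>C\<ge>0. \<forall>x\<in>K. norm (g x) \<le> C * norm (f x)"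
  shows "g \<in> Lp_loc \<Omega> p"
  unfolding Lp_loc_def
proof (intro CollectI conjI allI impI g)
  fix K assume K: "compact K \<and> K \<subseteq> \<Omega>"
  obtain C where C: "C \<ge> 0" "\<And>x. x \<in> K \<Longrightarrow> norm (g x) \<le> C * norm (f x)"
    using dom[of K] K by auto
  have "set_integrable lebesgue K (\<lambda>x. C powr p * norm (f x) powr p)"
    using Lp_loc_integrable[OF f, of K] K by simp
  moreover have "(\<lambda>x. norm (g x) powr p) \<in> borel_measurable (lebesgue_on K)"
    using measurable_lebesgue_on_subset[OF g] K by (intro borel_measurable_norm_powr) blast
  moreover have "norm (norm (g x) powr p) \<le> C powr p * norm (f x) powr p" if "x \<in> K" for x
    using powr_mono2[OF p _ C(2)[OF that]] C(1) by (simp add: powr_mult)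
  ultimately show "set_integrable lebesgue K (\<lambda>x. norm (g x) powr p)"
    using K by (elim set_integrable_dominated) (auto intro: compact_imp_sets_lebesgue)
qed

lemma Lp_loc_add:
  fixes f g :: "'a::euclidean_space \<Rightarrow> 'b::euclidean_space"
  assumes f: "f \<in> Lp_loc \<Omega> p" and g: "g \<in> Lp_loc \<Omega> p" and p: "0 \<le> p"
  shows "(\<lambda>x. f x + g x) \<in> Lp_loc \<Omega> p"
  unfolding Lp_loc_def
proof (intro CollectI conjI allI impI)
  note [measurable] = Lp_loc_measurable[OF f] Lp_loc_measurable[OF g]
  show meas: "(\<lambda>x. f x + g x) \<in> borel_measurable (lebesgue_on \<Omega>)"
    by measurable
  fix K assume K: "compact K \<and> K \<subseteq> \<Omega>"
  have "set_integrable lebesgue K (\<lambda>x. 2 powr p * (norm (f x) powr p + norm (g x) powr p))"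
    using Lp_loc_integrable[OF f, of K] Lp_loc_integrable[OF g, of K] K
    by (intro set_integrable_mult_right) (auto intro: set_integral_add)
  moreover have "(\<lambda>x. norm (f x + g x) powr p) \<in> borel_measurable (lebesgue_on K)"
    using measurable_lebesgue_on_subset[OF meas] K by (intro borel_measurable_norm_powr) blast
  moreover have "norm (norm (f x + g x) powr p) \<le> 2 powr p * (norm (f x) powr p + norm (g x) powr p)"
    for x
  proof -
    have "norm (f x + g x) \<le> 2 * max (norm (f x)) (norm (g x))"
      using norm_triangle_ineq[of "f x" "g x"] by linarith
    then have "norm (f x + g x) powr p \<le> (2 * max (norm (f x)) (norm (g x))) powr p"
      by (intro powr_mono2 p) auto
    also have "\<dots> = 2 powr p * max (norm (f x)) (norm (g x)) powr p"
      by (simp add: powr_mult)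
    also have "\<dots> \<le> 2 powr p * (norm (f x) powr p + norm (g x) powr p)"
      by (intro mult_left_mono) (auto simp: max_def)
    finally show ?thesis by simp
  qed
  ultimately show "set_integrable lebesgue K (\<lambda>x. norm (f x + g x) powr p)"
    using K by (elim set_integrable_dominated) (auto intro: compact_imp_sets_lebesgue)
qed

lemma Lp_loc_bilinear:
  fixes h :: "'c::euclidean_space \<Rightarrow> 'b::euclidean_space \<Rightarrow> 'd::euclidean_space"
  assumes h: "bounded_bilinear h" and \<Omega>: "open \<Omega>" and c: "continuous_on \<Omega> c"
    and f: "f \<in> Lp_loc \<Omega> p" and p: "0 \<le> p"
  shows "(\<lambda>x. h (c x) (f x)) \<in> Lp_loc \<Omega> p"
proof (rule Lp_loc_dominated[OF f p])
  have "continuous_on UNIV (\<lambda>z. h (fst z) (snd z))"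
    by (intro bounded_bilinear.continuous_on[OF h] continuous_intros)
  then show "(\<lambda>x. h (c x) (f x)) \<in> borel_measurable (lebesgue_on \<Omega>)"
    by (rule borel_measurable_continuous_Pair[rotated 2])
      (use \<Omega> in \<open>auto intro: continuous_imp_measurable_on_sets_lebesgue[OF c] Lp_loc_measurable[OF f]\<close>)
  fix K assume K: "compact K" "K \<subseteq> \<Omega>"
  then have "bounded (c ` K)"
    using c by (intro compact_imp_bounded compact_continuous_image) (auto intro: continuous_on_subset)
  then obtain C where C: "C > 0" "\<And>x. x \<in> K \<Longrightarrow> norm (c x) \<le> C"
    by (auto simp: bounded_pos)
  obtain B where B: "B \<ge> 0" "\<And>a b. norm (h a b) \<le> norm a * norm b * B"
    using bounded_bilinear.nonneg_bounded[OF h] by blast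
  have "norm (h (c x) (f x)) \<le> (C * B) * norm (f x)" if "x \<in> K" for x
  proof -
    have "norm (h (c x) (f x)) \<le> norm (c x) * norm (f x) * B" by (rule B)
    also have "\<dots> \<le> C * norm (f x) * B"
      using C(2)[OF that] B(1) by (intro mult_right_mono) auto
    finally show ?thesis by (simp add: mult_ac)
  qed
  moreover have "0 \<le> C * B" using B C by simp
  ultimately show "\<exists>C\<ge>0. \<forall>x\<in>K. norm (h (c x) (f x)) \<le> C * norm (f x)"
    by blast
qed

lemma Lp_loc_component:
  fixes g :: "real^'n \<Rightarrow> real^'n"
  assumes g: "g \<in> Lp_loc \<Omega> p" and p: "0 \<le> p"
  shows "(\<lambda>x. g x $ i) \<in> Lp_loc \<Omega> p"
proof (rule Lp_loc_dominated[OF g p])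
  have "continuous_on UNIV (\<lambda>v :: real^'n. v $ i)"
    by (intro continuous_intros)
  then show "(\<lambda>x. g x $ i) \<in> borel_measurable (lebesgue_on \<Omega>)"
    by (rule borel_measurable_continuous_on[OF _ Lp_loc_measurable[OF g]])
  show "\<exists>C\<ge>0. \<forall>x\<in>K. norm (g x $ i) \<le> C * norm (g x)" for K
    by (intro exI[of _ 1]) (simp add: component_le_norm_cart)
qed

lemma Lp_loc_times_compact_support_integrable:
  fixes f c :: "'a::euclidean_space \<Rightarrow> real"
  assumes \<Omega>: "open \<Omega>" and f: "f \<in> Lp_loc \<Omega> 1" and c: "continuous_on \<Omega> c"
    and K: "compact K" "K \<subseteq> \<Omega>" "\<And>x. x \<notin> K \<Longrightarrow> c x = 0"
  shows "set_integrable lebesgue \<Omega> (\<lambda>x. f x * c x)"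
proof -
  have "set_integrable lebesgue K (\<lambda>x. norm (f x * c x) powr 1)"
    using Lp_loc_integrable[OF Lp_loc_bilinear[OF bounded_bilinear_mult \<Omega> c f] K(1,2)]
    by (simp add: mult.commute)
  moreover have "(\<lambda>x. f x * c x) \<in> borel_measurable (lebesgue_on K)"
    using Lp_loc_measurable[OF Lp_loc_bilinear[OF bounded_bilinear_mult \<Omega> c f]]
    by (intro measurable_lebesgue_on_subset[OF _ K(2)]) (simp add: mult.commute)
  ultimately have "set_integrable lebesgue K (\<lambda>x. f x * c x)"
    using K(1) by (elim set_integrable_dominated) (auto intro: compact_imp_sets_lebesgue)
  moreover have "(\<lambda>x. indicator K x *\<^sub>R (f x * c x)) = (\<lambda>x. indicator \<Omega> x *\<^sub>R (f x * c x))"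
    by (rule ext) (use K in \<open>auto simp: indicator_def\<close>)
  ultimately show ?thesis
    unfolding set_integrable_def by metis
qed

lemma C1c_times_integrable:
  fixes f :: "'a::euclidean_space \<Rightarrow> real"
  assumes "open \<Omega>" "f \<in> Lp_loc \<Omega> 1" "\<phi> \<in> C1c \<Omega>"
  shows "set_integrable lebesgue \<Omega> (\<lambda>x. f x * \<phi> x)"
proof -
  obtain K where "compact K" "K \<subseteq> \<Omega>" "\<And>x. x \<notin> K \<Longrightarrow> \<phi> x = 0"
    using C1c_support[OF assms(3)] by metis
  then show ?thesis
    using assms by (intro Lp_loc_times_compact_support_integrable C1_on_continuous C1c_imp_C1_on)
qed

text \<open>Lebesgue measure is complete, so agreement almost everywhere transfers measurability and
  integrability. The main use is \<open>finsler_field N p (weak_gradient \<Omega> u x)\<close>, whose measurability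
  depends on \<open>N\<close>.\<close>
lemma set_integral_cong_AE_lebesgue:
  fixes f g :: "'a::euclidean_space \<Rightarrow> real"
  assumes "AE x in lebesgue. x \<in> S \<longrightarrow> f x = g x"
  shows "(LINT x:S|lebesgue. f x) = (LINT x:S|lebesgue. g x)"
proof -
  obtain N where N: "negligible N" "\<And>x. x \<in> S - N \<Longrightarrow> f x = g x"
    using assms unfolding completion.AE_iff_null_sets negligible_iff_null_sets by auto
  have iff: "set_integrable lebesgue S f \<longleftrightarrow> set_integrable lebesgue S g"
    using absolutely_integrable_spike[OF _ N(1)] N(2) by metis
  show ?thesis
  proof (cases "set_integrable lebesgue S f")
    case True
    have "integral S g = integral S f"
      by (rule integral_spike[OF N])
    with True iff show ?thesis
      by (simp add: set_lebesgue_integral_eq_integral)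
  next
    case False
    with iff show ?thesis
      by (simp add: set_lebesgue_integral_def set_integrable_def not_integrable_integral_eq)
  qed
qed

section \<open>The fundamental lemma of the calculus of variations\<close>

text \<open>If \<open>s\<close> is a \<open>C\<^sup>1\<close> function that is positive on the box and zero elsewhere, then
  \<open>s / (s + 1/k)\<close> takes values in \<open>[0, 1]\<close> and tends to the indicator of the box.\<close>
lemma box_cutoff:
  fixes a b :: "'a::euclidean_space"
  assumes "open \<Omega>" "cbox a b \<subseteq> \<Omega>"
  obtains \<phi> where "\<And>k::nat. \<phi> k \<in> C1c \<Omega>" "\<And>k x. 0 \<le> \<phi> k x" "\<And>k x. \<phi> k x \<le> 1"
    "\<And>k x. x \<notin> box a b \<Longrightarrow> \<phi> k x = 0" "\<And>x. (\<lambda>k. \<phi> k x) \<longlonglongrightarrow> indicator (box a b) x"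
proof -
  define s where "s x = (\<Prod>i\<in>Basis. (max 0 (x \<bullet> i - a \<bullet> i))\<^sup>2 * (max 0 (b \<bullet> i - x \<bullet> i))\<^sup>2)" for x
  have s_nonneg: "0 \<le> s x" for x
    unfolding s_def by (intro prod_nonneg) simp
  have s_pos: "s x \<noteq> 0 \<longleftrightarrow> x \<in> box a b" for x
    by (auto simp: s_def mem_box not_less max_def)
  have s_C1: "s \<in> C1_on \<Omega>"
    unfolding s_def
  proof (intro C1_on_prod C1_on_mult)
    fix i :: 'a
    have l: "(\<lambda>x. x \<bullet> i + (- (a \<bullet> i))) \<in> C1_on \<Omega>" "(\<lambda>x. b \<bullet> i + x \<bullet> (- i)) \<in> C1_on \<Omega>"
      by (intro C1_on_add C1_on_inner C1_on_const)+
    have "(\<lambda>x. (max 0 (x \<bullet> i + - (a \<bullet> i)))\<^sup>2) \<in> C1_on \<Omega>"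
      by (rule C1_on_compose_real[OF l(1) DERIV_max0_square]) (intro continuous_intros)
    moreover have "(\<lambda>x. (max 0 (b \<bullet> i + x \<bullet> - i))\<^sup>2) \<in> C1_on \<Omega>"
      by (rule C1_on_compose_real[OF l(2) DERIV_max0_square]) (intro continuous_intros)
    ultimately show "(\<lambda>x. (max 0 (x \<bullet> i - a \<bullet> i))\<^sup>2) \<in> C1_on \<Omega>" "(\<lambda>x. (max 0 (b \<bullet> i - x \<bullet> i))\<^sup>2) \<in> C1_on \<Omega>"
      by simp_all
  qed simp
  \<comment> \<open>\<open>Suc k\<close> keeps the denominator positive for \<open>k = 0\<close>.\<close>
  define \<phi> where "\<phi> k x = s x * inverse (s x + 1 / real (Suc k))" for k x
  have pos: "0 < s x + 1 / real (Suc k)" for x k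
    using s_nonneg[of x] by (simp add: add_nonneg_pos)
  show ?thesis
  proof
    show "\<phi> k \<in> C1c \<Omega>" for k
    proof (rule C1cI[OF assms(1) _ compact_cbox assms(2)])
      show "\<phi> k \<in> C1_on \<Omega>"
        unfolding \<phi>_def using s_C1 pos[of _ k]
        by (intro C1_on_mult C1_on_inverse C1_on_add C1_on_const) (auto simp: less_le)
      show "\<phi> k x = 0" if "x \<notin> cbox a b" for x
        using s_pos[of x] that box_subset_cbox[of a b] by (auto simp: \<phi>_def)
    qed
    show "0 \<le> \<phi> k x" for k x
      using s_nonneg[of x] pos[of x k] by (simp add: \<phi>_def)
    show "\<phi> k x \<le> 1" for k x
      using s_nonneg[of x] pos[of x k] by (simp add: \<phi>_def divide_simps)
    show "\<phi> k x = 0" if "x \<notin> box a b" for k x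
      using s_pos[of x] that by (simp add: \<phi>_def)
    show "(\<lambda>k. \<phi> k x) \<longlonglongrightarrow> indicator (box a b) x" for x
    proof (cases "x \<in> box a b")
      case True
      then have s: "s x \<noteq> 0" using s_pos by blast
      have "(\<lambda>k. \<phi> k x) \<longlonglongrightarrow> s x * inverse (s x + 0)"
        unfolding \<phi>_def using s
        by (intro tendsto_intros LIMSEQ_Suc[OF lim_1_over_n] ) auto
      then show ?thesis using s True by simp
    next
      case False
      then show ?thesis using s_pos[of x] by (simp add: \<phi>_def)
    qed
  qed
qed

lemma integral_box_eq_0:
  fixes f :: "'a::euclidean_space \<Rightarrow> real"
  assumes \<Omega>: "open \<Omega>" and f: "f \<in> Lp_loc \<Omega> 1"
    and zero: "\<And>\<phi>. \<phi> \<in> C1c \<Omega> \<Longrightarrow> (LINT x:\<Omega>|lebesgue. f x * \<phi> x) = 0"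
    and ab: "cbox a b \<subseteq> \<Omega>"
  shows "set_integrable lebesgue (box a b) f" "(LINT x:box a b|lebesgue. f x) = 0"
proof -
  obtain \<phi> where \<phi>: "\<And>k::nat. \<phi> k \<in> C1c \<Omega>" "\<And>k x. 0 \<le> \<phi> k x" "\<And>k x. \<phi> k x \<le> 1"
    "\<And>k x. x \<notin> box a b \<Longrightarrow> \<phi> k x = 0" "\<And>x. (\<lambda>k. \<phi> k x) \<longlonglongrightarrow> indicator (box a b) x"
    using box_cutoff[OF \<Omega> ab] by metis
  have sub: "box a b \<subseteq> \<Omega>"
    using ab box_subset_cbox by blast
  have "set_integrable lebesgue (cbox a b) (\<lambda>x. norm (f x))"
    using Lp_loc_integrable[OF f compact_cbox ab] by simp
  then have n: "set_integrable lebesgue (box a b) (\<lambda>x. norm (f x))"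
    by (rule set_integrable_subset) (auto simp: box_subset_cbox)
  have meas: "f \<in> borel_measurable (lebesgue_on (box a b))"
    by (rule measurable_lebesgue_on_subset[OF Lp_loc_measurable[OF f] sub])
  show int: "set_integrable lebesgue (box a b) f"
    by (rule set_integrable_dominated[OF n _ meas]) auto
  have "(\<lambda>k. LINT x|lebesgue. indicator \<Omega> x *\<^sub>R (f x * \<phi> k x))
      \<longlonglongrightarrow> (LINT x|lebesgue. indicator (box a b) x *\<^sub>R f x)"
  proof (rule integral_dominated_convergence[where w = "\<lambda>x. indicator (box a b) x *\<^sub>R norm (f x)"])
    show "(\<lambda>x. indicator (box a b) x *\<^sub>R f x) \<in> borel_measurable lebesgue"
      using int unfolding set_integrable_def by (rule borel_measurable_integrable)
    show "(\<lambda>x. indicator \<Omega> x *\<^sub>R (f x * \<phi> k x)) \<in> borel_measurable lebesgue" for k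
      using C1c_times_integrable[OF \<Omega> f \<phi>(1)] unfolding set_integrable_def
      by (rule borel_measurable_integrable)
    show "integrable lebesgue (\<lambda>x. indicator (box a b) x *\<^sub>R norm (f x))"
      using n unfolding set_integrable_def .
    show "AE x in lebesgue. (\<lambda>k. indicator \<Omega> x *\<^sub>R (f x * \<phi> k x)) \<longlonglongrightarrow> indicator (box a b) x *\<^sub>R f x"
    proof (rule AE_I2)
      fix x
      have "(\<lambda>k. indicator \<Omega> x *\<^sub>R (f x * \<phi> k x)) \<longlonglongrightarrow> indicator \<Omega> x *\<^sub>R (f x * indicator (box a b) x)"
        by (intro tendsto_intros \<phi>)
      moreover have "indicator \<Omega> x *\<^sub>R (f x * indicator (box a b) x) = indicator (box a b) x *\<^sub>R f x"
        using sub by (auto simp: indicator_def)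
      ultimately show "(\<lambda>k. indicator \<Omega> x *\<^sub>R (f x * \<phi> k x)) \<longlonglongrightarrow> indicator (box a b) x *\<^sub>R f x"
        by metis
    qed
    show "AE x in lebesgue. norm (indicator \<Omega> x *\<^sub>R (f x * \<phi> k x)) \<le> indicator (box a b) x *\<^sub>R norm (f x)" for k
    proof (rule AE_I2)
      fix x
      show "norm (indicator \<Omega> x *\<^sub>R (f x * \<phi> k x)) \<le> indicator (box a b) x *\<^sub>R norm (f x)"
        using \<phi>(2)[of k x] \<phi>(3)[of k x] \<phi>(4)[of x k]
        by (auto simp: indicator_def abs_mult mult_left_le)
    qed
  qed
  moreover have "(LINT x|lebesgue. indicator \<Omega> x *\<^sub>R (f x * \<phi> k x)) = 0" for k
    using zero[OF \<phi>(1)] by (simp add: set_lebesgue_integral_def)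
  ultimately show "(LINT x:box a b|lebesgue. f x) = 0"
    by (simp add: set_lebesgue_integral_def LIMSEQ_const_iff)
qed

text \<open>Boxes are closed under intersection and generate the Borel sets, so the integral of \<open>F\<close>
  vanishes on every Borel set by a Dynkin system argument; the vanishing of the total integral is
  what makes the step to complements work.\<close>
lemma AE_eq_0_if_box_integrals_eq_0:
  fixes F :: "'a::euclidean_space \<Rightarrow> real"
  assumes F: "integrable lborel F" and zero: "integral\<^sup>L lborel F = 0"
    and box: "\<And>a b. (LINT x:box a b|lborel. F x) = 0"
  shows "AE x in lborel. F x = 0"
proof (rule sigma_finite_measure.density_zero[OF sigma_finite_lborel F])
  have int: "set_integrable lborel A F" if "A \<in> sets borel" for A
    using integrable_mult_indicator[of A lborel F] F that by (simp add: set_integrable_def)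
  let ?E = "range (\<lambda>(a, b). box a b :: 'a set)"
  have borel: "sets borel = sigma_sets UNIV ?E"
    unfolding borel_eq_box by simp
  fix A :: "'a set" assume "A \<in> sets lborel"
  then have "Int_stable ?E" "?E \<subseteq> Pow UNIV" "A \<in> sigma_sets UNIV ?E"
    using borel by (auto simp: Int_stable_def box_Int_box)
  then show "(LINT x:A|lborel. F x) = 0"
  proof (induction rule: sigma_sets_induct_disjoint)
    case (basic A)
    then show ?case using box by auto
  next
    case empty
    show ?case by (simp add: set_lebesgue_integral_def)
  next
    case (compl A)
    then have A: "A \<in> sets borel" using borel by simp
    have "(LINT x:A \<union> (UNIV - A)|lborel. F x) = (LINT x:A|lborel. F x) + (LINT x:UNIV - A|lborel. F x)"
      using A by (intro set_integral_Un int) auto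
    then show ?case
      using compl zero by (simp add: set_lebesgue_integral_def)
  next
    case (union A)
    then have A: "A i \<in> sets borel" for i using borel by auto
    have "(LINT x:(\<Union>i. A i)|lborel. F x) = (\<Sum>i. (LINT x:A i|lborel. F x))"
      using A union(1) by (intro lebesgue_integral_countable_add int) (auto simp: disjoint_family_on_def)
    then show ?case
      using union by simp
  qed
qed

text \<open>By dominated convergence against the cutoffs, the integral of \<open>f\<close> over every box whose
  closure lies in \<open>\<Omega>\<close> is zero. Restricting \<open>f\<close> to one such box makes it integrable on the whole
  space, and countably many of these boxes cover \<open>\<Omega>\<close>.\<close>
theorem fundamental_lemma_calculus_of_variations:
  fixes f :: "'a::euclidean_space \<Rightarrow> real"
  assumes \<Omega>: "open \<Omega>" and f: "f \<in> Lp_loc \<Omega> 1"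
    and zero: "\<And>\<phi>. \<phi> \<in> C1c \<Omega> \<Longrightarrow> (LINT x:\<Omega>|lebesgue. f x * \<phi> x) = 0"
  shows "AE x in lebesgue. x \<in> \<Omega> \<longrightarrow> f x = 0"
proof -
  note box0 = integral_box_eq_0[OF \<Omega> f zero]
  have local: "AE x in lebesgue. x \<in> box c d \<longrightarrow> f x = 0" if cd: "cbox c d \<subseteq> \<Omega>" for c d
  proof -
    let ?g = "\<lambda>x. indicator (box c d) x *\<^sub>R f x"
    have g: "integrable lebesgue ?g"
      using box0(1)[OF _ cd] by (simp add: set_integrable_def)
    obtain F where F: "F \<in> borel_measurable lborel" "AE x in lborel. ?g x = F x"
      using completion_ex_borel_measurable_real[OF borel_measurable_integrable[OF g]] by blast
    have ae: "AE x in lebesgue. ?g x = F x"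
      by (rule AE_completion[OF F(2)])
    have F_leb: "F \<in> borel_measurable lebesgue"
      using F(1) by (rule measurable_completion)
    have "integrable lebesgue F"
      using integrable_cong_AE[THEN iffD1, OF _ F_leb ae g] borel_measurable_integrable[OF g] by blast
    then have int: "integrable lborel F"
      using integrable_completion[OF F(1)] by simp
    \<comment> \<open>\<open>F\<close> is zero almost everywhere outside \<open>box c d\<close>, and the intersection of two boxes is a box whose closure lies in
      \<open>\<Omega>\<close>.\<close>
    have box: "(LINT x:box a b|lborel. F x) = 0" for a b
    proof -
      obtain a' b' where ab': "box a b \<inter> box c d = box a' b'" "cbox a b \<inter> cbox c d = cbox a' b'"
        by (rule that[OF box_Int_box Int_interval])
      have m: "(\<lambda>x. indicator (box a b) x *\<^sub>R F x) \<in> borel_measurable lborel"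
        using F(1) by measurable
      have "(LINT x:box a b|lborel. F x) = (LINT x:box a b|lebesgue. F x)"
        unfolding set_lebesgue_integral_def by (rule integral_completion[OF m, symmetric])
      also have "\<dots> = (LINT x:box a b|lebesgue. ?g x)"
        by (rule set_integral_cong_AE_lebesgue) (use ae in auto)
      also have "\<dots> = (LINT x:box a' b'|lebesgue. f x)"
        unfolding ab'(1)[symmetric] set_lebesgue_integral_def by (simp add: indicator_inter_arith mult.assoc)
      also have "\<dots> = 0"
        by (rule box0(2)) (use ab'(2) cd in auto)
      finally show ?thesis .
    qed
    have "integral\<^sup>L lborel F = integral\<^sup>L lebesgue F"
      by (rule integral_completion[OF F(1), symmetric])
    also have "\<dots> = (LINT x:box c d|lebesgue. f x)"
      unfolding set_lebesgue_integral_def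
      by (rule integral_cong_AE) (use ae F_leb borel_measurable_integrable[OF g] in auto)
    also have "\<dots> = 0"
      using box0(2)[OF _ cd] by simp
    finally have "AE x in lborel. F x = 0"
      using AE_eq_0_if_box_integrals_eq_0[OF int _ box] by simp
    then have "AE x in lebesgue. F x = 0"
      by (rule AE_completion)
    with ae show ?thesis
      by eventually_elim (auto simp: indicator_def)
  qed
  have local': "AE x in lebesgue. x \<in> cbox c d \<longrightarrow> f x = 0" if cd: "cbox c d \<subseteq> \<Omega>" for c d
  proof -
    have "AE x in lebesgue. x \<notin> cbox c d - box c d"
      using negligible_frontier_interval[of c d] negligible_iff_null_sets AE_not_in by blast
    with local[OF cd] show ?thesis
      by eventually_elim auto
  qed
  obtain \<D> where \<D>: "countable \<D>" "\<D> \<subseteq> Pow \<Omega>" "\<And>X. X \<in> \<D> \<Longrightarrow> \<exists>a b. X = cbox a b" "\<Union>\<D> = \<Omega>"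
    using open_countable_Union_open_cbox[OF \<Omega>] by metis
  have "AE x in lebesgue. \<forall>X\<in>\<D>. x \<in> X \<longrightarrow> f x = 0"
  proof (subst AE_ball_countable[OF \<D>(1)], intro ballI)
    fix X assume "X \<in> \<D>"
    with \<D>(2,3) obtain a b where "X = cbox a b" "cbox a b \<subseteq> \<Omega>"
      by blast
    with local' show "AE x in lebesgue. x \<in> X \<longrightarrow> f x = 0"
      by blast
  qed
  then show ?thesis
    by eventually_elim (use \<D>(4) in auto)
qed

section \<open>Weak gradients\<close>

lemma has_weak_gradient_D:
  assumes "has_weak_gradient \<Omega> u g" "\<phi> \<in> C1c \<Omega>"
  shows "(LINT x:\<Omega>|lebesgue. u x * gradient \<phi> x $ i) = - (LINT x:\<Omega>|lebesgue. g x $ i * \<phi> x)"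
  using assms by (simp add: has_weak_gradient_def)

lemma has_weak_gradient_Lp_loc:
  "has_weak_gradient \<Omega> u g \<Longrightarrow> u \<in> Lp_loc \<Omega> 1" "has_weak_gradient \<Omega> u g \<Longrightarrow> g \<in> Lp_loc \<Omega> 1"
  by (simp_all add: has_weak_gradient_def)

lemma weak_gradient_unique:
  fixes g h :: "real^'n \<Rightarrow> real^'n"
  assumes \<Omega>: "open \<Omega>" and g: "has_weak_gradient \<Omega> u g" and h: "has_weak_gradient \<Omega> u h"
  shows "AE x in lebesgue. x \<in> \<Omega> \<longrightarrow> g x = h x"
proof -
  have "AE x in lebesgue. x \<in> \<Omega> \<longrightarrow> g x $ i + (-1) * h x $ i = 0" for i
  proof (rule fundamental_lemma_calculus_of_variations[OF \<Omega>])
    have gi: "(\<lambda>x. g x $ i) \<in> Lp_loc \<Omega> 1" and hi: "(\<lambda>x. h x $ i) \<in> Lp_loc \<Omega> 1"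
      using g h by (simp_all add: has_weak_gradient_Lp_loc Lp_loc_component)
    have hi': "(\<lambda>x. (-1) * h x $ i) \<in> Lp_loc \<Omega> 1"
      using Lp_loc_bilinear[OF bounded_bilinear_mult \<Omega> continuous_on_const[of _ "-1"] hi] by simp
    show "(\<lambda>x. g x $ i + (-1) * h x $ i) \<in> Lp_loc \<Omega> 1"
      by (rule Lp_loc_add[OF gi hi']) simp
    fix \<phi> assume \<phi>: "\<phi> \<in> C1c \<Omega>"
    have "(LINT x:\<Omega>|lebesgue. (g x $ i + (-1) * h x $ i) * \<phi> x)
        = (LINT x:\<Omega>|lebesgue. g x $ i * \<phi> x) - (LINT x:\<Omega>|lebesgue. h x $ i * \<phi> x)"
      using C1c_times_integrable[OF \<Omega> gi \<phi>] C1c_times_integrable[OF \<Omega> hi \<phi>]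
      by (simp add: left_diff_distrib)
    also have "\<dots> = 0"
      using has_weak_gradient_D[OF g \<phi>, of i] has_weak_gradient_D[OF h \<phi>, of i] by simp
    finally show "(LINT x:\<Omega>|lebesgue. (g x $ i + (-1) * h x $ i) * \<phi> x) = 0" .
  qed
  then have "AE x in lebesgue. \<forall>i. x \<in> \<Omega> \<longrightarrow> g x $ i + (-1) * h x $ i = 0"
    by (subst AE_all_countable) simp
  then show ?thesis
    by eventually_elim (simp add: vec_eq_iff)
qed

lemma weak_gradient_AE_eq:
  assumes "open \<Omega>" "has_weak_gradient \<Omega> u g"
  shows "AE x in lebesgue. x \<in> \<Omega> \<longrightarrow> weak_gradient \<Omega> u x = g x"
  using weak_gradient_unique[OF assms(1) _ assms(2)] someI[of "has_weak_gradient \<Omega> u", OF assms(2)]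
  by (simp add: weak_gradient_def)

lemma has_weak_gradient_weak_gradient:
  "u \<in> W1p_loc \<Omega> p \<Longrightarrow> has_weak_gradient \<Omega> u (weak_gradient \<Omega> u)"
  unfolding W1p_loc_def weak_gradient_def using someI_ex[of "has_weak_gradient \<Omega> u"] by blast

lemma finsler_laplacian_eq:
  assumes "open \<Omega>" "has_weak_gradient \<Omega> u g"
  shows "finsler_laplacian \<Omega> N p u \<phi>
    = - (LINT x:\<Omega>|lebesgue. finsler_field N p (g x) \<bullet> gradient \<phi> x)"
proof -
  have "(LINT x:\<Omega>|lebesgue. finsler_field N p (weak_gradient \<Omega> u x) \<bullet> gradient \<phi> x)
      = (LINT x:\<Omega>|lebesgue. finsler_field N p (g x) \<bullet> gradient \<phi> x)"
    by (rule set_integral_cong_AE_lebesgue, rule eventually_mono[OF weak_gradient_AE_eq[OF assms]]) simp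
  then show ?thesis
    by (simp add: finsler_laplacian_def)
qed

text \<open>Test with \<open>k \<phi>\<close> instead of \<open>\<phi>\<close>. Integrals of sums may be split because each term
  is a locally integrable function times a continuous one of compact support.\<close>
lemma has_weak_gradient_mult:
  fixes u k :: "real^'n \<Rightarrow> real"
  assumes \<Omega>: "open \<Omega>" and k: "k \<in> C1_on \<Omega>" and u: "has_weak_gradient \<Omega> u g"
  shows "has_weak_gradient \<Omega> (\<lambda>x. k x * u x) (\<lambda>x. k x *\<^sub>R g x + u x *\<^sub>R gradient k x)"
  unfolding has_weak_gradient_def
proof (intro conjI ballI allI)
  note uL = has_weak_gradient_Lp_loc(1)[OF u] and gL = has_weak_gradient_Lp_loc(2)[OF u]
  note kc = C1_on_continuous[OF k] and kg = C1_on_gradient[OF k]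
  show "(\<lambda>x. k x * u x) \<in> Lp_loc \<Omega> 1"
    by (rule Lp_loc_bilinear[OF bounded_bilinear_mult \<Omega> kc uL]) simp
  show "(\<lambda>x. k x *\<^sub>R g x + u x *\<^sub>R gradient k x) \<in> Lp_loc \<Omega> 1"
    by (intro Lp_loc_add Lp_loc_bilinear[OF bounded_bilinear_scaleR \<Omega> kc gL]
        Lp_loc_bilinear[OF bounded_bilinear.flip[OF bounded_bilinear_scaleR] \<Omega> kg uL]) simp_all
  fix \<phi> and i :: 'n assume \<phi>: "\<phi> \<in> C1c \<Omega>"
  obtain K where K: "compact K" "K \<subseteq> \<Omega>" "\<And>x. x \<notin> K \<Longrightarrow> \<phi> x = 0" "\<And>x. x \<notin> K \<Longrightarrow> gradient \<phi> x = 0"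
    using C1c_support[OF \<phi>] by metis
  note \<phi>C1 = C1c_imp_C1_on[OF \<Omega> \<phi>]
  note cont = kc kg C1_on_continuous[OF \<phi>C1] C1_on_gradient[OF \<phi>C1]
  have k\<phi>: "(\<lambda>x. k x * \<phi> x) \<in> C1c \<Omega>"
    by (rule C1c_mult[OF \<Omega> k \<phi>])
  have gi: "(\<lambda>x. g x $ i) \<in> Lp_loc \<Omega> 1"
    by (rule Lp_loc_component[OF gL]) simp
  have I1: "set_integrable lebesgue \<Omega> (\<lambda>x. u x * (k x * gradient \<phi> x $ i))"
    by (rule Lp_loc_times_compact_support_integrable[OF \<Omega> uL _ K(1,2)])
      (use K(4) in \<open>auto intro!: continuous_intros cont\<close>)
  have I2: "set_integrable lebesgue \<Omega> (\<lambda>x. u x * (\<phi> x * gradient k x $ i))"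
    by (rule Lp_loc_times_compact_support_integrable[OF \<Omega> uL _ K(1,2)])
      (use K(3) in \<open>auto intro!: continuous_intros cont\<close>)
  have I3: "set_integrable lebesgue \<Omega> (\<lambda>x. g x $ i * (k x * \<phi> x))"
    by (rule C1c_times_integrable[OF \<Omega> gi k\<phi>])
  have "(LINT x:\<Omega>|lebesgue. u x * (k x * gradient \<phi> x $ i)) + (LINT x:\<Omega>|lebesgue. u x * (\<phi> x * gradient k x $ i))
      = (LINT x:\<Omega>|lebesgue. u x * (k x * gradient \<phi> x $ i) + u x * (\<phi> x * gradient k x $ i))"
    by (rule set_integral_add(2)[OF I1 I2, symmetric])
  also have "\<dots> = (LINT x:\<Omega>|lebesgue. u x * gradient (\<lambda>x. k x * \<phi> x) x $ i)"
    by (rule set_integral_cong_AE_lebesgue, rule AE_I2, rule impI, subst gradient_mult[OF k \<phi>C1])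
      (simp_all add: distrib_left)
  also have "\<dots> = - (LINT x:\<Omega>|lebesgue. g x $ i * (k x * \<phi> x))"
    by (rule has_weak_gradient_D[OF u k\<phi>])
  finally have "(LINT x:\<Omega>|lebesgue. u x * (k x * gradient \<phi> x $ i))
      = - ((LINT x:\<Omega>|lebesgue. g x $ i * (k x * \<phi> x)) + (LINT x:\<Omega>|lebesgue. u x * (\<phi> x * gradient k x $ i)))"
    by simp
  also have "\<dots> = - (LINT x:\<Omega>|lebesgue. g x $ i * (k x * \<phi> x) + u x * (\<phi> x * gradient k x $ i))"
    using set_integral_add(2)[OF I3 I2] by simp
  finally show "(LINT x:\<Omega>|lebesgue. k x * u x * gradient \<phi> x $ i)
      = - (LINT x:\<Omega>|lebesgue. (k x *\<^sub>R g x + u x *\<^sub>R gradient k x) $ i * \<phi> x)"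
    by (simp add: algebra_simps)
qed

lemma W1p_loc_mult:
  fixes u k :: "real^'n \<Rightarrow> real"
  assumes \<Omega>: "open \<Omega>" and k: "k \<in> C1_on \<Omega>" and u: "u \<in> W1p_loc \<Omega> p" and p: "0 \<le> p"
  shows "(\<lambda>x. k x * u x) \<in> W1p_loc \<Omega> p"
proof -
  obtain g where g: "has_weak_gradient \<Omega> u g" "g \<in> Lp_loc \<Omega> p" and uL: "u \<in> Lp_loc \<Omega> p"
    using u unfolding W1p_loc_def by blast
  note kc = C1_on_continuous[OF k] and kg = C1_on_gradient[OF k]
  have "(\<lambda>x. k x * u x) \<in> Lp_loc \<Omega> p"
    by (rule Lp_loc_bilinear[OF bounded_bilinear_mult \<Omega> kc uL p])
  moreover have "(\<lambda>x. k x *\<^sub>R g x + u x *\<^sub>R gradient k x) \<in> Lp_loc \<Omega> p"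
    by (intro Lp_loc_add p Lp_loc_bilinear[OF bounded_bilinear_scaleR \<Omega> kc g(2)]
        Lp_loc_bilinear[OF bounded_bilinear.flip[OF bounded_bilinear_scaleR] \<Omega> kg uL])
  ultimately show ?thesis
    using has_weak_gradient_mult[OF \<Omega> k g(1)] unfolding W1p_loc_def by blast
qed

section \<open>Diffeomorphisms\<close>

lemma continuous_on_det:
  fixes A :: "'a::topological_space \<Rightarrow> real^'n^'n"
  shows "continuous_on S A \<Longrightarrow> continuous_on S (\<lambda>x. det (A x))"
  unfolding det_def by (intro continuous_intros)

lemma inner_matrix_transpose: "(A *v h) \<bullet> w = h \<bullet> (transpose A *v w)" for A :: "real^'n^'m"
  using dot_lmul_matrix[of w A h] by (simp add: inner_commute)

text \<open>A test function is a total function that vanishes outside \<open>\<Omega>\<close>. Requiring that \<open>\<Phi>\<close>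
  and \<open>\<Psi>\<close> also map the complement of \<open>\<Omega>\<close> to itself makes the plain composition
  \<open>\<phi> \<circ> \<Phi>\<close> a test function, without a case distinction.\<close>
locale diffeo =
  fixes \<Omega> :: "(real^'n) set" and \<Phi> \<Psi> :: "real^'n \<Rightarrow> real^'n" and D\<Phi> D\<Psi> :: "real^'n \<Rightarrow> real^'n^'n"
  assumes open_\<Omega>: "open \<Omega>"
    and \<Phi>_in_iff: "\<Phi> x \<in> \<Omega> \<longleftrightarrow> x \<in> \<Omega>" and \<Psi>_in_iff: "\<Psi> x \<in> \<Omega> \<longleftrightarrow> x \<in> \<Omega>"
    and \<Psi>\<Phi>: "x \<in> \<Omega> \<Longrightarrow> \<Psi> (\<Phi> x) = x" and \<Phi>\<Psi>: "x \<in> \<Omega> \<Longrightarrow> \<Phi> (\<Psi> x) = x"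
    and deriv_\<Phi>: "x \<in> \<Omega> \<Longrightarrow> (\<Phi> has_derivative (*v) (D\<Phi> x)) (at x)"
    and deriv_\<Psi>: "x \<in> \<Omega> \<Longrightarrow> (\<Psi> has_derivative (*v) (D\<Psi> x)) (at x)"
    and cont_D\<Phi>: "continuous_on \<Omega> D\<Phi>" and cont_D\<Psi>: "continuous_on \<Omega> D\<Psi>"
begin

lemma inverse_diffeo: "diffeo \<Omega> \<Psi> \<Phi> D\<Psi> D\<Phi>"
  by unfold_locales
    (auto simp: \<Phi>_in_iff \<Psi>_in_iff \<Psi>\<Phi> \<Phi>\<Psi> deriv_\<Phi> deriv_\<Psi> cont_D\<Phi> cont_D\<Psi> open_\<Omega>)

lemma D_inverse:
  assumes "x \<in> \<Omega>"
  shows "D\<Psi> (\<Phi> x) ** D\<Phi> x = mat 1" "D\<Phi> x ** D\<Psi> (\<Phi> x) = mat 1"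
proof -
  have "((\<lambda>x. \<Psi> (\<Phi> x)) has_derivative (\<lambda>h. D\<Psi> (\<Phi> x) *v (D\<Phi> x *v h))) (at x)"
    using has_derivative_compose[OF deriv_\<Phi>[OF assms] deriv_\<Psi>[of "\<Phi> x"]] assms by (simp add: \<Phi>_in_iff)
  moreover have "((\<lambda>x. \<Psi> (\<Phi> x)) has_derivative (\<lambda>h. h)) (at x)"
    using has_derivative_transform_within_open[OF has_derivative_ident open_\<Omega> assms] \<Psi>\<Phi> by metis
  ultimately have "(\<lambda>h. D\<Psi> (\<Phi> x) *v (D\<Phi> x *v h)) = (\<lambda>h. h)"
    by (rule has_derivative_unique)
  then have "(D\<Psi> (\<Phi> x) ** D\<Phi> x) *v h = mat 1 *v h" for h
    by (metis matrix_vector_mul_assoc matrix_vector_mul_lid)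
  then show *: "D\<Psi> (\<Phi> x) ** D\<Phi> x = mat 1"
    by (simp add: matrix_eq)
  show "D\<Phi> x ** D\<Psi> (\<Phi> x) = mat 1"
    using * matrix_left_right_inverse by blast
qed

lemma abs_det_inverse: "x \<in> \<Omega> \<Longrightarrow> \<bar>det (D\<Psi> (\<Phi> x))\<bar> * \<bar>det (D\<Phi> x)\<bar> = 1"
  using D_inverse(1)[of x] by (metis abs_mult abs_one det_I det_mul)

lemma image_\<Omega>: "\<Phi> ` \<Omega> = \<Omega>"
  by (metis (no_types, lifting) \<Phi>\<Psi> \<Phi>_in_iff \<Psi>_in_iff image_iff subsetI subset_antisym image_subsetI)

lemma continuous_\<Phi>: "continuous_on \<Omega> \<Phi>"
  by (intro continuous_at_imp_continuous_on ballI has_derivative_continuous[OF deriv_\<Phi>])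

lemma compact_image: "compact K \<Longrightarrow> K \<subseteq> \<Omega> \<Longrightarrow> compact (\<Phi> ` K)"
  using continuous_\<Phi> by (metis compact_continuous_image continuous_on_subset)

lemma image_subset: "K \<subseteq> \<Omega> \<Longrightarrow> \<Phi> ` K \<subseteq> \<Omega>"
  by (auto simp: \<Phi>_in_iff)

lemma inj_on_\<Phi>: "K \<subseteq> \<Omega> \<Longrightarrow> inj_on \<Phi> K"
  by (metis \<Psi>\<Phi> inj_onI subsetD)

lemma
  fixes f :: "real^'n \<Rightarrow> real"
  assumes "K \<subseteq> \<Omega>" "K \<in> sets lebesgue"
  shows set_integrable_image: "set_integrable lebesgue (\<Phi> ` K) f
      \<longleftrightarrow> set_integrable lebesgue K (\<lambda>x. \<bar>det (D\<Phi> x)\<bar> * f (\<Phi> x))"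
    and set_integral_image: "(LINT y:\<Phi> ` K|lebesgue. f y) = (LINT x:K|lebesgue. \<bar>det (D\<Phi> x)\<bar> * f (\<Phi> x))"
proof -
  have "(\<Phi> has_derivative (*v) (D\<Phi> x)) (at x within K)" if "x \<in> K" for x
    using deriv_\<Phi>[of x] assms(1) that by (auto intro: has_derivative_at_withinI)
  from set_integrable_change_of_variables[OF assms(2) this inj_on_\<Phi>[OF assms(1)]]
    set_integral_change_of_variables[OF assms(2) this inj_on_\<Phi>[OF assms(1)]]
  show "set_integrable lebesgue (\<Phi> ` K) f \<longleftrightarrow> set_integrable lebesgue K (\<lambda>x. \<bar>det (D\<Phi> x)\<bar> * f (\<Phi> x))"
    "(LINT y:\<Phi> ` K|lebesgue. f y) = (LINT x:K|lebesgue. \<bar>det (D\<Phi> x)\<bar> * f (\<Phi> x))"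
    by simp_all
qed

lemma set_integral_transform:
  fixes f :: "real^'n \<Rightarrow> real"
  shows "(LINT y:\<Omega>|lebesgue. f y) = (LINT x:\<Omega>|lebesgue. \<bar>det (D\<Phi> x)\<bar> * f (\<Phi> x))"
  using set_integral_image[OF subset_refl, of f] image_\<Omega> open_\<Omega> by simp

lemma measurable_compose:
  fixes f :: "real^'n \<Rightarrow> 'b::euclidean_space"
  assumes "f \<in> borel_measurable (lebesgue_on \<Omega>)"
  shows "(\<lambda>x. f (\<Phi> x)) \<in> borel_measurable (lebesgue_on \<Omega>)"
proof (rule measurableI)
  have \<Omega>: "\<Omega> \<in> sets lebesgue" using open_\<Omega> by simp
  fix A :: "'b set" assume "A \<in> sets borel"
  then have "f -` A \<inter> \<Omega> \<in> sets (lebesgue_on \<Omega>)"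
    using measurable_sets[OF assms] by simp
  then have m: "f -` A \<inter> \<Omega> \<in> sets lebesgue"
    using \<Omega> by (simp add: sets_restrict_space_iff)
  have "\<Psi> ` (f -` A \<inter> \<Omega>) \<in> sets lebesgue"
  proof (rule differentiable_image_in_sets_lebesgue[OF m])
    show "\<Psi> differentiable_on f -` A \<inter> \<Omega>"
      unfolding differentiable_on_def differentiable_def
      using deriv_\<Psi> has_derivative_at_withinI by blast
  qed simp
  moreover have "\<Psi> ` (f -` A \<inter> \<Omega>) = (\<lambda>x. f (\<Phi> x)) -` A \<inter> \<Omega>"
  proof (intro equalityI subsetI)
    fix x assume "x \<in> (\<lambda>x. f (\<Phi> x)) -` A \<inter> \<Omega>"
    then show "x \<in> \<Psi> ` (f -` A \<inter> \<Omega>)"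
      by (intro image_eqI[of _ _ "\<Phi> x"]) (auto simp: \<Psi>\<Phi> \<Phi>_in_iff)
  qed (auto simp: \<Phi>\<Psi> \<Psi>_in_iff)
  ultimately show "(\<lambda>x. f (\<Phi> x)) -` A \<inter> space (lebesgue_on \<Omega>) \<in> sets (lebesgue_on \<Omega>)"
    using \<Omega> by (simp add: sets_restrict_space_iff)
qed simp

text \<open>The change of variables puts the Jacobian in front of the integrand. On a compact set it is
  removed again by multiplying with the Jacobian of the inverse, which is bounded there.\<close>
lemma Lp_loc_compose:
  fixes f :: "real^'n \<Rightarrow> 'b::euclidean_space"
  assumes f: "f \<in> Lp_loc \<Omega> p"
  shows "(\<lambda>x. f (\<Phi> x)) \<in> Lp_loc \<Omega> p"
  unfolding Lp_loc_def
proof (intro CollectI conjI allI impI measurable_compose Lp_loc_measurable[OF f])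
  fix K assume "compact K \<and> K \<subseteq> \<Omega>"
  then have K: "compact K" "K \<subseteq> \<Omega>" "K \<in> sets lebesgue"
    by (auto simp: compact_imp_sets_lebesgue)
  have "set_integrable lebesgue (\<Phi> ` K) (\<lambda>y. norm (f y) powr p)"
    by (rule Lp_loc_integrable[OF f compact_image[OF K(1,2)] image_subset[OF K(2)]])
  then have int: "set_integrable lebesgue K (\<lambda>x. \<bar>det (D\<Phi> x)\<bar> * norm (f (\<Phi> x)) powr p)"
    by (rule set_integrable_image[OF K(2,3), THEN iffD1])
  have c: "continuous_on K (\<lambda>x. \<bar>det (D\<Psi> (\<Phi> x))\<bar>)"
    by (intro continuous_intros continuous_on_det continuous_on_compose2[OF cont_D\<Psi>]
        continuous_on_subset[OF continuous_\<Phi> K(2)] image_subset K)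
  have "set_integrable lebesgue K (\<lambda>x. \<bar>det (D\<Psi> (\<Phi> x))\<bar> * (\<bar>det (D\<Phi> x)\<bar> * norm (f (\<Phi> x)) powr p))"
    by (rule absolutely_integrable_bounded_measurable_product[OF bilinear_times _ K(3) _ int])
      (use c K in \<open>auto intro: continuous_imp_measurable_on_sets_lebesgue compact_imp_bounded compact_continuous_image\<close>)
  moreover have "\<bar>det (D\<Psi> (\<Phi> x))\<bar> * (\<bar>det (D\<Phi> x)\<bar> * norm (f (\<Phi> x)) powr p) = norm (f (\<Phi> x)) powr p"
    if "x \<in> K" for x
    using abs_det_inverse[of x] that K(2) by (simp add: mult.assoc[symmetric] subset_iff)
  ultimately show "set_integrable lebesgue K (\<lambda>x. norm (f (\<Phi> x)) powr p)"
    using set_integrable_cong[of lebesgue lebesgue K K] by (metis (no_types, lifting))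
qed

lemma GDERIV_compose:
  assumes f: "f \<in> C1_on \<Omega>" and x: "x \<in> \<Omega>"
  shows "GDERIV (\<lambda>x. f (\<Phi> x)) x :> transpose (D\<Phi> x) *v gradient f (\<Phi> x)"
proof -
  have "(f has_derivative (\<lambda>h. h \<bullet> gradient f (\<Phi> x))) (at (\<Phi> x))"
    using C1_onD[OF f] x \<Phi>_in_iff by (simp add: gderiv_def)
  from has_derivative_compose[OF deriv_\<Phi>[OF x] this]
  show ?thesis
    by (simp add: gderiv_def inner_matrix_transpose)
qed

lemma gradient_compose:
  "f \<in> C1_on \<Omega> \<Longrightarrow> x \<in> \<Omega> \<Longrightarrow> gradient (\<lambda>x. f (\<Phi> x)) x = transpose (D\<Phi> x) *v gradient f (\<Phi> x)"
  by (rule gradient_eqI, rule GDERIV_compose)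

lemma bounded_bilinear_matrix_vector: "bounded_bilinear (\<lambda>(A :: real^'n^'n) v. transpose A *v v)"
  unfolding bilinear_conv_bounded_bilinear[symmetric] bilinear_def
  by (auto intro!: linearI simp: vec_eq_iff matrix_vector_mult_def transpose_def algebra_simps
      sum.distrib sum_distrib_left)

lemma C1_on_compose:
  assumes f: "f \<in> C1_on \<Omega>"
  shows "(\<lambda>x. f (\<Phi> x)) \<in> C1_on \<Omega>"
proof (rule C1_onI, rule GDERIV_compose[OF f])
  show "continuous_on \<Omega> (\<lambda>x. transpose (D\<Phi> x) *v gradient f (\<Phi> x))"
    by (intro bounded_bilinear.continuous_on[OF bounded_bilinear_matrix_vector] cont_D\<Phi>
        continuous_on_compose2[OF C1_on_gradient[OF f] continuous_\<Phi>]) (simp add: image_\<Omega>)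
qed

lemma inv_into_eq: "y \<in> \<Omega> \<Longrightarrow> inv_into \<Omega> \<Phi> y = \<Psi> y"
  by (rule inv_into_f_eq[OF inj_on_\<Phi>[OF subset_refl]]) (simp_all add: \<Psi>_in_iff \<Phi>\<Psi>)

lemma jacobian_inv_into:
  assumes y: "y \<in> \<Omega>"
  shows "jacobian (inv_into \<Omega> \<Phi>) (at y) = D\<Psi> y"
proof -
  have "(inv_into \<Omega> \<Phi> has_derivative (*v) (D\<Psi> y)) (at y)"
    by (rule has_derivative_transform_within_open[OF deriv_\<Psi>[OF y] open_\<Omega> y]) (simp add: inv_into_eq)
  then show ?thesis
    by (simp add: jacobian_def frechet_derivative_at[symmetric])
qed

lemma fun_comp_eq:
  assumes "\<And>x. x \<notin> \<Omega> \<Longrightarrow> \<phi> x = 0"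
  shows "fun_comp \<Omega> S \<Phi> \<phi> = S (\<lambda>y. \<bar>det (D\<Psi> y)\<bar> * \<phi> (\<Psi> y))"
  unfolding fun_comp_def
  by (rule arg_cong[where f = S]) (use assms in \<open>auto simp: jacobian_inv_into inv_into_eq \<Psi>_in_iff\<close>)

lemma C1c_compose:
  assumes f: "\<phi> \<in> C1c \<Omega>"
  shows "(\<lambda>x. \<phi> (\<Phi> x)) \<in> C1c \<Omega>"
proof -
  obtain K where K: "compact K" "K \<subseteq> \<Omega>" "\<And>x. x \<notin> K \<Longrightarrow> \<phi> x = 0"
    using C1c_support[OF f] by metis
  interpret inv: diffeo \<Omega> \<Psi> \<Phi> D\<Psi> D\<Phi> by (rule inverse_diffeo)
  show ?thesis
  proof (rule C1cI[OF open_\<Omega> C1_on_compose[OF C1c_imp_C1_on[OF open_\<Omega> f]] inv.compact_image[OF K(1,2)] inv.image_subset[OF K(2)]])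
    fix x assume x: "x \<notin> \<Psi> ` K"
    show "\<phi> (\<Phi> x) = 0"
    proof (cases "\<Phi> x \<in> K")
      case True
      then have "x \<in> \<Omega>" using K(2) \<Phi>_in_iff by blast
      with True x show ?thesis using \<Psi>\<Phi> by (metis imageI)
    qed (use K(3) in auto)
  qed
qed

end

lemma bounded_bilinear_matrix_mult: "bounded_bilinear (\<lambda>(A :: real^'n^'n) (B :: real^'n^'n). A ** B)"
  unfolding bilinear_conv_bounded_bilinear[symmetric] bilinear_def
  by (auto intro!: linearI simp: vec_eq_iff matrix_matrix_mult_def algebra_simps
      sum.distrib sum_distrib_left)

lemma diffeo_compose:
  assumes "diffeo \<Omega> \<Phi> \<Psi> D\<Phi> D\<Psi>" "diffeo \<Omega> \<Phi>' \<Psi>' D\<Phi>' D\<Psi>'"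
  shows "diffeo \<Omega> (\<lambda>x. \<Phi>' (\<Phi> x)) (\<lambda>y. \<Psi> (\<Psi>' y))
    (\<lambda>x. D\<Phi>' (\<Phi> x) ** D\<Phi> x) (\<lambda>y. D\<Psi> (\<Psi>' y) ** D\<Psi>' y)"
proof -
  interpret f: diffeo \<Omega> \<Phi> \<Psi> D\<Phi> D\<Psi> by fact
  interpret g: diffeo \<Omega> \<Phi>' \<Psi>' D\<Phi>' D\<Psi>' by fact
  interpret f': diffeo \<Omega> \<Psi> \<Phi> D\<Psi> D\<Phi> by (rule f.inverse_diffeo)
  interpret g': diffeo \<Omega> \<Psi>' \<Phi>' D\<Psi>' D\<Phi>' by (rule g.inverse_diffeo)
  show ?thesis
  proof
    show "((\<lambda>x. \<Phi>' (\<Phi> x)) has_derivative (*v) (D\<Phi>' (\<Phi> x) ** D\<Phi> x)) (at x)" if "x \<in> \<Omega>" for x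
      using has_derivative_compose[OF f.deriv_\<Phi>[OF that] g.deriv_\<Phi>[of "\<Phi> x"]] that
      by (simp add: f.\<Phi>_in_iff matrix_vector_mul_assoc)
    show "((\<lambda>y. \<Psi> (\<Psi>' y)) has_derivative (*v) (D\<Psi> (\<Psi>' y) ** D\<Psi>' y)) (at y)" if "y \<in> \<Omega>" for y
      using has_derivative_compose[OF g.deriv_\<Psi>[OF that] f.deriv_\<Psi>[of "\<Psi>' y"]] that
      by (simp add: g.\<Psi>_in_iff matrix_vector_mul_assoc)
    show "continuous_on \<Omega> (\<lambda>x. D\<Phi>' (\<Phi> x) ** D\<Phi> x)"
      by (intro bounded_bilinear.continuous_on[OF bounded_bilinear_matrix_mult] f.cont_D\<Phi>
          continuous_on_compose2[OF g.cont_D\<Phi> f.continuous_\<Phi>]) (simp add: f.image_\<Omega>)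
    show "continuous_on \<Omega> (\<lambda>y. D\<Psi> (\<Psi>' y) ** D\<Psi>' y)"
      by (intro bounded_bilinear.continuous_on[OF bounded_bilinear_matrix_mult] g.cont_D\<Psi>
          continuous_on_compose2[OF f.cont_D\<Psi> g'.continuous_\<Phi>]) (simp add: g'.image_\<Omega>)
  qed (simp_all add: f.open_\<Omega> f.\<Phi>_in_iff f.\<Psi>_in_iff g.\<Phi>_in_iff g.\<Psi>_in_iff f.\<Psi>\<Phi> g.\<Psi>\<Phi> f.\<Phi>\<Psi> g.\<Phi>\<Psi>)
qed

section \<open>The Piola identity and the weak chain rule\<close>

lemma set_integral_sum_real:
  fixes f :: "'i \<Rightarrow> 'a \<Rightarrow> real"
  assumes "\<And>i. set_integrable M A (f i)"
  shows "(LINT x:A|M. (\<Sum>i\<in>I. f i x)) = (\<Sum>i\<in>I. (LINT x:A|M. f i x))"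
  using assms unfolding set_lebesgue_integral_def set_integrable_def scaleR_sum_right
  by (intro Bochner_Integration.integral_sum)

text \<open>The Piola identity says that the columns of \<open>\<bar>det D\<Psi>\<bar> (D\<Psi>)\<^sup>-\<^sup>1\<close>, the adjugate of
  \<open>D\<Psi>\<close> up to sign, are divergence free for a diffeomorphism \<open>\<Psi>\<close>; here it is written with
  \<open>(D\<Psi> y)\<^sup>-\<^sup>1 = D\<Phi> (\<Psi> y)\<close>. It holds for every \<open>C\<^sup>2\<close> diffeomorphism; as a locale assumption
  it can be checked by hand for the two explicit maps of interest, and it is exactly what makes the
  pullback of a test function's partial derivative a divergence again.\<close>

locale piola_diffeo = diffeo +
  assumes piola_C1: "(\<lambda>y. \<bar>det (D\<Psi> y)\<bar> * D\<Phi> (\<Psi> y) $ j $ i) \<in> C1_on \<Omega>"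
    and piola_div: "y \<in> \<Omega> \<Longrightarrow> (\<Sum>j\<in>UNIV. gradient (\<lambda>y. \<bar>det (D\<Psi> y)\<bar> * D\<Phi> (\<Psi> y) $ j $ i) y $ j) = 0"
begin

text \<open>For a test function \<open>\<phi>\<close>, let \<open>W\<close> be the \<open>i\<close>-th column of \<open>\<bar>det D\<Psi>\<bar> (D\<Psi>)\<^sup>-\<^sup>1\<close> times
  \<open>\<phi> \<circ> \<Psi>\<close> (the Piola transform of \<open>\<phi> e\<^sub>i\<close>). Its divergence at \<open>y\<close> is
  \<open>\<bar>det D\<Psi>\<bar> \<partial>\<^sub>i\<phi> (\<Psi> y)\<close>, so the integral of
  \<open>(u \<circ> \<Phi>) \<partial>\<^sub>i\<phi>\<close> becomes that of \<open>u div W\<close>. The components of \<open>W\<close> are test functions for the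
  weak gradient of \<open>u\<close>, and changing variables back produces the transposed derivative of
  \<open>\<Phi>\<close>.\<close>
lemma has_weak_gradient_compose:
  assumes u: "has_weak_gradient \<Omega> u g"
  shows "has_weak_gradient \<Omega> (\<lambda>x. u (\<Phi> x)) (\<lambda>x. transpose (D\<Phi> x) *v g (\<Phi> x))"
  unfolding has_weak_gradient_def
proof (intro conjI ballI allI)
  interpret inv: diffeo \<Omega> \<Psi> \<Phi> D\<Psi> D\<Phi> by (rule inverse_diffeo)
  note uL = has_weak_gradient_Lp_loc(1)[OF u] and gL = has_weak_gradient_Lp_loc(2)[OF u]
  show "(\<lambda>x. u (\<Phi> x)) \<in> Lp_loc \<Omega> 1"
    by (rule Lp_loc_compose[OF uL])
  show "(\<lambda>x. transpose (D\<Phi> x) *v g (\<Phi> x)) \<in> Lp_loc \<Omega> 1"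
    by (rule Lp_loc_bilinear[OF bounded_bilinear_matrix_vector open_\<Omega> cont_D\<Phi> Lp_loc_compose[OF gL]]) simp
  fix \<phi> and i assume \<phi>: "\<phi> \<in> C1c \<Omega>"
  define A where "A = (\<lambda>j y. \<bar>det (D\<Psi> y)\<bar> * D\<Phi> (\<Psi> y) $ j $ i)"
  define W where "W j y = A j y * \<phi> (\<Psi> y)" for j y
  have A: "A j \<in> C1_on \<Omega>" for j
    unfolding A_def by (rule piola_C1)
  have \<phi>\<Psi>: "(\<lambda>y. \<phi> (\<Psi> y)) \<in> C1c \<Omega>"
    by (rule inv.C1c_compose[OF \<phi>])
  have W: "W j \<in> C1c \<Omega>" for j
    unfolding W_def by (rule C1c_mult[OF open_\<Omega> A \<phi>\<Psi>])
  have A_sum: "(\<Sum>j\<in>UNIV. A j y * v $ j) = \<bar>det (D\<Psi> y)\<bar> * (transpose (D\<Phi> (\<Psi> y)) *v v) $ i" for y v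
    by (simp add: A_def matrix_vector_mult_def transpose_def sum_distrib_left mult.assoc)
  have div_W: "(\<Sum>j\<in>UNIV. gradient (W j) y $ j) = \<bar>det (D\<Psi> y)\<bar> * gradient \<phi> (\<Psi> y) $ i" if y: "y \<in> \<Omega>" for y
  proof -
    have "gradient (W j) y = A j y *\<^sub>R (transpose (D\<Psi> y) *v gradient \<phi> (\<Psi> y)) + \<phi> (\<Psi> y) *\<^sub>R gradient (A j) y" for j
      unfolding W_def
      by (simp add: gradient_mult[OF A C1c_imp_C1_on[OF open_\<Omega> \<phi>\<Psi>] y]
          inv.gradient_compose[OF C1c_imp_C1_on[OF open_\<Omega> \<phi>] y])
    then have "(\<Sum>j\<in>UNIV. gradient (W j) y $ j)
        = (\<Sum>j\<in>UNIV. A j y * (transpose (D\<Psi> y) *v gradient \<phi> (\<Psi> y)) $ j)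
          + \<phi> (\<Psi> y) * (\<Sum>j\<in>UNIV. gradient (A j) y $ j)"
      by (simp add: sum.distrib sum_distrib_left)
    also have "(\<Sum>j\<in>UNIV. gradient (A j) y $ j) = 0"
      using piola_div[OF y] by (simp add: A_def)
    also have "transpose (D\<Phi> (\<Psi> y)) *v (transpose (D\<Psi> y) *v gradient \<phi> (\<Psi> y)) = gradient \<phi> (\<Psi> y)"
      by (simp only: matrix_vector_mul_assoc matrix_transpose_mul[symmetric] inv.D_inverse(2)[OF y]
          transpose_mat matrix_vector_mul_lid)
    then have "(\<Sum>j\<in>UNIV. A j y * (transpose (D\<Psi> y) *v gradient \<phi> (\<Psi> y)) $ j)
        = \<bar>det (D\<Psi> y)\<bar> * gradient \<phi> (\<Psi> y) $ i"
      by (simp add: A_sum)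
    finally show ?thesis by simp
  qed
  have I1: "set_integrable lebesgue \<Omega> (\<lambda>y. u y * gradient (W j) y $ j)" for j
  proof -
    obtain K where K: "compact K" "K \<subseteq> \<Omega>" "\<And>x. x \<notin> K \<Longrightarrow> gradient (W j) x = 0"
      using C1c_support[OF W] by metis
    then show ?thesis
      by (intro Lp_loc_times_compact_support_integrable[OF open_\<Omega> uL _ K(1,2)])
        (auto intro!: continuous_intros C1_on_gradient C1c_imp_C1_on[OF open_\<Omega> W])
  qed
  have I2: "set_integrable lebesgue \<Omega> (\<lambda>y. g y $ j * W j y)" for j
    by (rule C1c_times_integrable[OF open_\<Omega> Lp_loc_component[OF gL] W]) simp
  have "(LINT x:\<Omega>|lebesgue. u (\<Phi> x) * gradient \<phi> x $ i)
      = (LINT y:\<Omega>|lebesgue. \<bar>det (D\<Psi> y)\<bar> * (u (\<Phi> (\<Psi> y)) * gradient \<phi> (\<Psi> y) $ i))"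
    by (rule inv.set_integral_transform)
  also have "\<dots> = (LINT y:\<Omega>|lebesgue. (\<Sum>j\<in>UNIV. u y * gradient (W j) y $ j))"
    by (rule set_integral_cong_AE_lebesgue) (simp add: \<Phi>\<Psi> div_W sum_distrib_left[symmetric])
  also have "\<dots> = (\<Sum>j\<in>UNIV. (LINT y:\<Omega>|lebesgue. u y * gradient (W j) y $ j))"
    by (rule set_integral_sum_real[OF I1])
  also have "\<dots> = - (\<Sum>j\<in>UNIV. (LINT y:\<Omega>|lebesgue. g y $ j * W j y))"
    by (simp add: has_weak_gradient_D[OF u W] sum_negf)
  also have "(\<Sum>j\<in>UNIV. (LINT y:\<Omega>|lebesgue. g y $ j * W j y))
      = (LINT y:\<Omega>|lebesgue. (\<Sum>j\<in>UNIV. g y $ j * W j y))"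
    by (rule set_integral_sum_real[OF I2, symmetric])
  also have "\<dots> = (LINT y:\<Omega>|lebesgue. \<bar>det (D\<Psi> y)\<bar> *
      ((transpose (D\<Phi> (\<Psi> y)) *v g (\<Phi> (\<Psi> y))) $ i * \<phi> (\<Psi> y)))"
  proof (rule set_integral_cong_AE_lebesgue, rule AE_I2, rule impI)
    fix y assume y: "y \<in> \<Omega>"
    have "(\<Sum>j\<in>UNIV. g y $ j * W j y) = (\<Sum>j\<in>UNIV. A j y * g y $ j) * \<phi> (\<Psi> y)"
      by (simp add: W_def sum_distrib_left mult_ac)
    then show "(\<Sum>j\<in>UNIV. g y $ j * W j y) = \<bar>det (D\<Psi> y)\<bar> *
        ((transpose (D\<Phi> (\<Psi> y)) *v g (\<Phi> (\<Psi> y))) $ i * \<phi> (\<Psi> y))"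
      by (simp add: A_sum \<Phi>\<Psi>[OF y])
  qed
  also have "\<dots> = (LINT x:\<Omega>|lebesgue. (transpose (D\<Phi> x) *v g (\<Phi> x)) $ i * \<phi> x)"
    by (rule inv.set_integral_transform[symmetric])
  finally show "(LINT x:\<Omega>|lebesgue. u (\<Phi> x) * gradient \<phi> x $ i)
      = - (LINT x:\<Omega>|lebesgue. (transpose (D\<Phi> x) *v g (\<Phi> x)) $ i * \<phi> x)" .
qed

lemma W1p_loc_compose:
  assumes u: "u \<in> W1p_loc \<Omega> p" and p: "0 \<le> p"
  shows "(\<lambda>x. u (\<Phi> x)) \<in> W1p_loc \<Omega> p"
proof -
  obtain g where g: "has_weak_gradient \<Omega> u g" "g \<in> Lp_loc \<Omega> p" and uL: "u \<in> Lp_loc \<Omega> p"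
    using u unfolding W1p_loc_def by blast
  have "(\<lambda>x. transpose (D\<Phi> x) *v g (\<Phi> x)) \<in> Lp_loc \<Omega> p"
    by (rule Lp_loc_bilinear[OF bounded_bilinear_matrix_vector open_\<Omega> cont_D\<Phi> Lp_loc_compose[OF g(2)] p])
  then show ?thesis
    using has_weak_gradient_compose[OF g(1)] Lp_loc_compose[OF uL] unfolding W1p_loc_def by blast
qed

end

section \<open>Linear maps and the inversion\<close>

lemma gradient_const [simp]: "gradient (\<lambda>x. c) x = 0"
  by (rule gradient_eqI, rule GDERIV_const)

lemma linear_piola_diffeo:
  fixes L L' :: "real^'n^'n"
  assumes "L ** L' = mat 1" "L' ** L = mat 1"
  shows "piola_diffeo (UNIV - {0}) ((*v) L) ((*v) L') (\<lambda>_. L) (\<lambda>_. L')"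
proof
  have inv: "L *v (L' *v x) = x" "L' *v (L *v x) = x" for x
    using assms by (simp_all add: matrix_vector_mul_assoc)
  then have "L *v x = 0 \<longleftrightarrow> x = 0" "L' *v x = 0 \<longleftrightarrow> x = 0" for x
    by (metis matrix_vector_mult_0_right)+
  then show "L *v x \<in> UNIV - {0} \<longleftrightarrow> x \<in> UNIV - {0}" "L' *v x \<in> UNIV - {0} \<longleftrightarrow> x \<in> UNIV - {0}" for x
    by simp_all
  show "L' *v (L *v x) = x" "L *v (L' *v x) = x" for x
    by (simp_all only: inv)
  show "((*v) L has_derivative (*v) L) (at x)" "((*v) L' has_derivative (*v) L') (at x)" for x
    by (intro bounded_linear_imp_has_derivative matrix_vector_mul_bounded_linear)+
qed (auto intro: C1_on_const)

definition inversion :: "real^'n \<Rightarrow> real^'n" where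
  "inversion x = x /\<^sub>R (x \<bullet> x)"

text \<open>The reflection in the hyperplane orthogonal to \<open>x\<close>. It is the identity for \<open>x = 0\<close>, because
  then the quotient is zero; hence the orthogonality lemmas below hold for all \<open>x\<close>.\<close>
definition reflection :: "real^'n \<Rightarrow> real^'n^'n" where
  "reflection x = (\<chi> i j. (if i = j then 1 else 0) - 2 * x $ i * x $ j / (x \<bullet> x))"

definition D_inversion :: "real^'n \<Rightarrow> real^'n^'n" where
  "D_inversion x = inverse (x \<bullet> x) *\<^sub>R reflection x"

lemma reflection_mult: "reflection x *v h = h - (2 * (x \<bullet> h) / (x \<bullet> x)) *\<^sub>R x"
proof -
  have "(\<Sum>j\<in>UNIV. ((if i = j then 1 else 0) - 2 * x $ i * x $ j / (x \<bullet> x)) * h $ j)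
      = h $ i - 2 * (x \<bullet> h) / (x \<bullet> x) * x $ i" for i
  proof -
    have "(\<Sum>j\<in>UNIV. ((if i = j then 1 else 0) - 2 * x $ i * x $ j / (x \<bullet> x)) * h $ j)
        = (\<Sum>j\<in>UNIV. (if i = j then h $ j else 0) - 2 * x $ i / (x \<bullet> x) * (x $ j * h $ j))"
      by (intro sum.cong) (auto simp: algebra_simps)
    also have "\<dots> = h $ i - 2 * x $ i / (x \<bullet> x) * (\<Sum>j\<in>UNIV. x $ j * h $ j)"
      by (simp add: sum_subtractf sum_distrib_left)
    also have "(\<Sum>j\<in>UNIV. x $ j * h $ j) = x \<bullet> h"
      by (simp add: inner_vec_def)
    finally show ?thesis by (simp add: mult_ac)
  qed
  then show ?thesis
    by (simp add: vec_eq_iff matrix_vector_mult_def reflection_def)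
qed

lemma transpose_reflection: "transpose (reflection x) = reflection x"
  by (simp add: transpose_def reflection_def vec_eq_iff mult_ac)

lemma reflection_involution: "reflection x ** reflection x = mat 1"
proof -
  have "reflection x *v (reflection x *v h) = h" for h
  proof (cases "x = 0")
    case False
    define c where "c = 2 * (x \<bullet> h) / (x \<bullet> x)"
    have "2 * (x \<bullet> (h - c *\<^sub>R x)) / (x \<bullet> x) = - c"
      using False by (simp add: c_def inner_diff_right field_simps)
    then show ?thesis
      by (simp add: reflection_mult flip: c_def)
  qed (simp add: reflection_mult)
  then show ?thesis
    by (simp add: matrix_eq matrix_vector_mul_assoc[symmetric])
qed

lemma inner_reflection: "(reflection x *v a) \<bullet> (reflection x *v b) = a \<bullet> b"
  unfolding inner_matrix_transpose
  by (simp only: transpose_reflection matrix_vector_mul_assoc reflection_involution matrix_vector_mul_lid)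

lemma abs_det_reflection: "\<bar>det (reflection x)\<bar> = 1"
proof -
  have "det (reflection x) * det (reflection x) = 1"
    by (simp add: reflection_involution flip: det_mul)
  then show ?thesis
    by (auto simp: square_eq_1_iff)
qed

lemma det_scaleR: "det (c *\<^sub>R A) = c ^ CARD('n) * det A" for A :: "real^'n^'n"
proof -
  have "c *\<^sub>R A = matrix ((*\<^sub>R) c) ** A"
    by (simp add: matrix_eq matrix_vector_mul_assoc[symmetric] matrix_works scaleR_matrix_vector_assoc
        linear_scaleR)
  then show ?thesis by (simp add: det_mul)
qed

lemma abs_det_D_inversion: "\<bar>det (D_inversion (x :: real^'n))\<bar> = inverse (x \<bullet> x) ^ CARD('n)"
  by (simp add: D_inversion_def det_scaleR abs_mult abs_det_reflection power_abs)

lemma inversion_in_iff: "inversion x \<in> UNIV - {0} \<longleftrightarrow> x \<in> UNIV - {0}"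
  by (simp add: inversion_def)

lemma inner_inversion: "inversion x \<bullet> inversion x = inverse (x \<bullet> x)"
  by (cases "x = 0") (simp_all add: inversion_def)

lemma norm_inversion: "norm (inversion x) = inverse (norm x)"
  by (simp add: inversion_def power2_norm_eq_inner[symmetric] power2_eq_square field_simps)

lemma inversion_involution: "inversion (inversion x) = x"
  by (cases "x = 0") (simp_all add: inversion_def)

lemma reflection_scaleR: "c \<noteq> 0 \<Longrightarrow> reflection (c *\<^sub>R x) = reflection x"
  by (simp add: reflection_def vec_eq_iff)

lemma reflection_inversion: "reflection (inversion x) = reflection x"
  by (cases "x = 0") (simp_all add: inversion_def reflection_scaleR)

lemma D_inversion_inversion: "D_inversion (inversion x) = (x \<bullet> x) *\<^sub>R reflection x"
  by (simp add: D_inversion_def reflection_inversion inner_inversion)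

lemma deriv_inversion:
  assumes "x \<noteq> 0"
  shows "(inversion has_derivative (*v) (D_inversion x)) (at x)"
proof -
  have "((\<lambda>x. inverse (x \<bullet> x) *\<^sub>R x) has_derivative
      (\<lambda>h. inverse (x \<bullet> x) *\<^sub>R h + (- (inverse (x \<bullet> x) * (x \<bullet> h + h \<bullet> x) * inverse (x \<bullet> x))) *\<^sub>R x)) (at x)"
    using assms by (auto intro!: derivative_eq_intros)
  moreover have "(\<lambda>h. inverse (x \<bullet> x) *\<^sub>R h + (- (inverse (x \<bullet> x) * (x \<bullet> h + h \<bullet> x) * inverse (x \<bullet> x))) *\<^sub>R x)
      = (*v) (D_inversion x)"
    by (simp add: fun_eq_iff D_inversion_def scaleR_matrix_vector_assoc[symmetric] reflection_mult
        scaleR_diff_right inner_commute divide_inverse mult_ac)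
  ultimately show ?thesis
    by (simp add: inversion_def[abs_def])
qed

lemma continuous_D_inversion: "continuous_on (UNIV - {0}) (D_inversion :: real^'n \<Rightarrow> _)"
  unfolding D_inversion_def reflection_def
  by (intro continuous_intros) auto

lemma GDERIV_inverse_inner_power:
  fixes y :: "real^'n"
  assumes "y \<noteq> 0"
  shows "GDERIV (\<lambda>y. inverse (y \<bullet> y) ^ m) y :> (- 2 * real m * inverse (y \<bullet> y) ^ (m + 1)) *\<^sub>R y"
proof -
  have "GDERIV (\<lambda>y. y \<bullet> y) y :> 2 *\<^sub>R y"
    unfolding gderiv_def by (auto intro!: derivative_eq_intros simp: inner_commute)
  moreover have "DERIV (\<lambda>t. inverse t ^ m) (y \<bullet> y) :> - real m * inverse (y \<bullet> y) ^ (m + 1)"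
    by (rule DERIV_cong[OF DERIV_power[OF DERIV_inverse]]) (use assms in \<open>cases m; simp add: algebra_simps\<close>)+
  ultimately show ?thesis
    using GDERIV_DERIV_compose by (fastforce simp: mult_ac)
qed

lemma C1_on_inverse_inner_power: "(\<lambda>y :: real^'n. inverse (y \<bullet> y) ^ m) \<in> C1_on (UNIV - {0})"
proof (rule C1_onI)
  show "GDERIV (\<lambda>y. inverse (y \<bullet> y) ^ m) y :> (- 2 * real m * inverse (y \<bullet> y) ^ (m + 1)) *\<^sub>R y"
    if "y \<in> UNIV - {0}" for y :: "real^'n"
    using that by (intro GDERIV_inverse_inner_power) simp
  show "continuous_on (UNIV - {0}) (\<lambda>y :: real^'n. (- 2 * real m * inverse (y \<bullet> y) ^ (m + 1)) *\<^sub>R y)"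
    by (intro continuous_intros) auto
qed

lemma C1_on_component: "(\<lambda>y :: real^'n. y $ i) \<in> C1_on \<Omega>"
  using C1_on_inner[of "axis i 1" \<Omega>] by (simp add: cart_eq_inner_axis)

lemma gradient_component: "gradient (\<lambda>y :: real^'n. y $ i) y = axis i 1"
  by (rule gradient_eqI) (auto simp: gderiv_def cart_eq_inner_axis intro!: derivative_eq_intros)

lemma gradient_cong_open:
  assumes "open \<Omega>" "x \<in> \<Omega>" "\<And>y. y \<in> \<Omega> \<Longrightarrow> f y = g y"
  shows "gradient f x = gradient g x"
proof -
  have "GDERIV f x :> D \<longleftrightarrow> GDERIV g x :> D" for D
    unfolding gderiv_def
    using has_derivative_transform_within_open[OF _ assms(1,2)] assms(3) by metis
  then show ?thesis by (simp add: gradient_def)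
qed

lemma C1_on_cong_open:
  assumes "open \<Omega>" "\<And>y. y \<in> \<Omega> \<Longrightarrow> f y = g y" "g \<in> C1_on \<Omega>"
  shows "f \<in> C1_on \<Omega>"
proof (rule C1_onI)
  show "GDERIV f x :> gradient g x" if "x \<in> \<Omega>" for x
    using C1_onD[OF assms(3) that] has_derivative_transform_within_open[OF _ assms(1) that] assms(2)
    unfolding gderiv_def by metis
qed (rule C1_on_gradient[OF assms(3)])

text \<open>Let \<open>n\<close> be the dimension and \<open>\<rho> = y \<bullet> y\<close>. The adjugate has, up to sign, the entries
  \<open>\<alpha>\<^sub>j\<^sub>i = \<delta>\<^sub>j\<^sub>i \<rho>\<^bsup>1-n\<^esup> - 2 y\<^sub>j y\<^sub>i \<rho>\<^bsup>-n\<^esup>\<close>. Summing \<open>\<partial>\<^sub>j \<alpha>\<^sub>j\<^sub>i\<close> over \<open>j\<close> gives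
  \<open>\<rho>\<^bsup>-n\<^esup> y\<^sub>i\<close> times \<open>2 (1 - n) - 2 (n + 1) + 4 n = 0\<close>.\<close>
lemma inversion_piola_diffeo:
  "piola_diffeo (UNIV - {0}) inversion inversion D_inversion (D_inversion :: real^'n \<Rightarrow> _)"
proof
  let ?\<Omega> = "UNIV - {0 :: real^'n}"
  have \<Omega>: "open ?\<Omega>" by (simp add: open_delete)
  fix i j :: 'n
  define \<alpha> where "\<alpha> j i = (\<lambda>y. (if j = i then 1 else 0) * inverse (y \<bullet> y) ^ (CARD('n) - 1)
      + (- 2) * (y $ j * (y $ i * inverse (y \<bullet> y) ^ CARD('n))))" for j i :: 'n
  note C1 = C1_on_add C1_on_mult C1_on_const C1_on_component C1_on_inverse_inner_power
  have \<alpha>: "\<bar>det (D_inversion y)\<bar> * D_inversion (inversion y) $ j $ i = \<alpha> j i y" if "y \<in> ?\<Omega>" for y j i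
  proof -
    have "inverse (y \<bullet> y) ^ CARD('n) * (y \<bullet> y)
        = inverse (y \<bullet> y) ^ (CARD('n) - 1) * inverse (y \<bullet> y) * (y \<bullet> y)"
      by (simp only: power_minus_mult zero_less_card_finite)
    also have "\<dots> = inverse (y \<bullet> y) ^ (CARD('n) - 1)"
      using that by simp
    finally have "inverse (y \<bullet> y) ^ CARD('n) * (y \<bullet> y) = inverse (y \<bullet> y) ^ (CARD('n) - 1)" .
    then show ?thesis
      using that by (simp add: abs_det_D_inversion D_inversion_inversion reflection_def \<alpha>_def
          right_diff_distrib mult.assoc[symmetric])
  qed
  show "(\<lambda>y. \<bar>det (D_inversion y)\<bar> * D_inversion (inversion y) $ j $ i) \<in> C1_on ?\<Omega>"
  proof (rule C1_on_cong_open[OF \<Omega>])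
    show "\<alpha> j i \<in> C1_on ?\<Omega>"
      unfolding \<alpha>_def by (intro C1)
  qed (rule \<alpha>)
  fix y :: "real^'n" assume y: "y \<in> ?\<Omega>"
  let ?r = "inverse (y \<bullet> y)" and ?n = "CARD('n)"
  have "gradient (\<lambda>y. \<bar>det (D_inversion y)\<bar> * D_inversion (inversion y) $ j $ i) y $ j
      = (if j = i then 1 else 0) * (- 2 * (real ?n - 1) * ?r ^ ?n * y $ j)
        - 2 * ?r ^ ?n * y $ i - 2 * (if j = i then 1 else 0) * ?r ^ ?n * y $ j
        + 4 * real ?n * ?r ^ (?n + 1) * y $ i * (y $ j * y $ j)" for j
  proof -
    have "gradient (\<lambda>y. \<bar>det (D_inversion y)\<bar> * D_inversion (inversion y) $ j $ i) y = gradient (\<alpha> j i) y"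
      by (rule gradient_cong_open[OF \<Omega> y]) (rule \<alpha>)
    also have "\<dots> = (if j = i then 1 else 0) *\<^sub>R ((- 2 * (real ?n - 1) * ?r ^ ?n) *\<^sub>R y)
        + (- 2) *\<^sub>R (y $ j *\<^sub>R (y $ i *\<^sub>R ((- 2 * real ?n * ?r ^ (?n + 1)) *\<^sub>R y) + ?r ^ ?n *\<^sub>R axis i 1)
            + (y $ i * ?r ^ ?n) *\<^sub>R axis j 1)"
    proof -
      have "GDERIV (\<alpha> j i) y :> ((if j = i then 1 else 0) *\<^sub>R ((- 2 * real (?n - 1) * ?r ^ (?n - 1 + 1)) *\<^sub>R y)
            + (?r ^ (?n - 1)) *\<^sub>R 0)
          + ((- 2) *\<^sub>R (y $ j *\<^sub>R (y $ i *\<^sub>R ((- 2 * real ?n * ?r ^ (?n + 1)) *\<^sub>R y) + ?r ^ ?n *\<^sub>R axis i 1)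
            + (y $ i * ?r ^ ?n) *\<^sub>R axis j 1) + (y $ j * (y $ i * ?r ^ ?n)) *\<^sub>R 0)"
        unfolding \<alpha>_def
        using y C1_onD[OF C1_on_component, of y UNIV, unfolded gradient_component]
        by (intro GDERIV_add GDERIV_mult GDERIV_const GDERIV_inverse_inner_power) simp_all
      then show ?thesis
        by (subst gradient_eqI) (simp_all add: of_nat_diff)
    qed
    finally have "gradient (\<lambda>y. \<bar>det (D_inversion y)\<bar> * D_inversion (inversion y) $ j $ i) y $ j = \<dots> $ j"
      by (rule arg_cong)
    then show ?thesis
      by (cases "j = i") (simp_all add: axis_def algebra_simps)
  qed
  then have "(\<Sum>j\<in>UNIV. gradient (\<lambda>y. \<bar>det (D_inversion y)\<bar> * D_inversion (inversion y) $ j $ i) y $ j)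
      = (\<Sum>j\<in>UNIV. (if j = i then - 2 * (real ?n - 1) * ?r ^ ?n * y $ i - 2 * ?r ^ ?n * y $ i else 0)
        + (- 2 * ?r ^ ?n * y $ i) + 4 * real ?n * ?r ^ (?n + 1) * y $ i * (y $ j * y $ j))"
    by (intro sum.cong) auto
  also have "\<dots> = (- 2 * (real ?n - 1) * ?r ^ ?n * y $ i - 2 * ?r ^ ?n * y $ i)
      + real ?n * (- 2 * ?r ^ ?n * y $ i) + 4 * real ?n * ?r ^ (?n + 1) * y $ i * (\<Sum>j\<in>UNIV. y $ j * y $ j)"
    by (simp add: sum.distrib sum_subtractf sum_distrib_left)
  also have "(\<Sum>j\<in>UNIV. y $ j * y $ j) = y \<bullet> y"
    by (simp add: inner_vec_def)
  also have "4 * real ?n * ?r ^ (?n + 1) * y $ i * (y \<bullet> y) = 4 * real ?n * ?r ^ ?n * y $ i"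
    using y by simp
  finally show "(\<Sum>j\<in>UNIV. gradient (\<lambda>y. \<bar>det (D_inversion y)\<bar> * D_inversion (inversion y) $ j $ i) y $ j) = 0"
    by (simp add: algebra_simps)
qed (auto simp: inversion_in_iff inversion_involution continuous_D_inversion open_delete
    intro: deriv_inversion simp del: Diff_iff)

section \<open>Finsler fields of Hilbert norms\<close>

lemma matrix_inj_iff:
  fixes Q Q' :: "real^'n^'n"
  assumes "Q' ** Q = mat 1"
  shows "Q *v x = 0 \<longleftrightarrow> x = 0"
  using assms by (metis matrix_vector_mul_assoc matrix_vector_mul_lid matrix_vector_mult_0_right)

lemma gradient_norm_linear:
  fixes Q Q' :: "real^'n^'n"
  assumes "Q' ** Q = mat 1" "\<xi> \<noteq> 0"
  shows "gradient (\<lambda>\<xi>. norm (Q *v \<xi>)) \<xi> = transpose Q *v sgn (Q *v \<xi>)"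
proof (rule gradient_eqI)
  have "Q *v \<xi> \<noteq> 0"
    using assms by (simp add: matrix_inj_iff)
  then have "(norm has_derivative (\<lambda>h. h \<bullet> sgn (Q *v \<xi>))) (at (Q *v \<xi>))"
    using GDERIV_norm unfolding gderiv_def by blast
  from has_derivative_compose[OF bounded_linear_imp_has_derivative[OF matrix_vector_mul_bounded_linear] this]
  show "GDERIV (\<lambda>\<xi>. norm (Q *v \<xi>)) \<xi> :> transpose Q *v sgn (Q *v \<xi>)"
    unfolding gderiv_def by (simp only: inner_matrix_transpose)
qed

text \<open>Only the gradient factor of \<open>N\<^bsup>p-1\<^esup> \<nabla>N\<close> picks up the transpose of \<open>Q\<close>, by the chain
  rule; the scalar factor is merely evaluated at \<open>Q \<xi>\<close>.\<close>
lemma finsler_field_linear: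
  fixes Q Q' :: "real^'n^'n"
  assumes Q: "Q' ** Q = mat 1"
  shows "finsler_field (\<lambda>\<xi>. norm (Q *v \<xi>)) p \<xi> = transpose Q *v finsler_field norm p (Q *v \<xi>)"
proof (cases "\<xi> = 0")
  case False
  then have nz: "Q *v \<xi> \<noteq> 0"
    using Q by (simp add: matrix_inj_iff)
  then have "gradient norm (Q *v \<xi>) = sgn (Q *v \<xi>)"
    by (intro gradient_eqI GDERIV_norm)
  then show ?thesis
    using False nz by (simp only: finsler_field_def gradient_norm_linear[OF Q False] if_False matrix_vector_mult_scaleR)
qed (simp add: finsler_field_def)

text \<open>The norm \<open>N\<close> is chosen such that \<open>N\<close> of the pulled back gradient
  \<open>L\<^sup>T \<nabla>w (L x)\<close> is the Euclidean norm of \<open>\<nabla>w (L x)\<close>. The test function on the right is that of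
  \<open>fun_comp\<close> for the map \<open>L\<close>.\<close>
lemma finsler_laplacian_linear:
  fixes L L' :: "real^'n^'n"
  assumes L: "L ** L' = mat 1" "L' ** L = mat 1"
    and w: "w \<in> W1p_loc (UNIV - {0}) q" and \<phi>: "\<phi> \<in> C1c (UNIV - {0})"
    and N: "N = (\<lambda>\<xi>. norm (transpose L' *v \<xi>))"
  shows "finsler_laplacian (UNIV - {0}) N p (\<lambda>x. w (L *v x)) \<phi>
    = finsler_laplacian (UNIV - {0}) norm p w (\<lambda>y. \<bar>det L'\<bar> * \<phi> (L' *v y))"
proof -
  let ?\<Omega> = "UNIV - {0 :: real^'n}"
  interpret L: piola_diffeo ?\<Omega> "(*v) L" "(*v) L'" "\<lambda>_. L" "\<lambda>_. L'"
    by (rule linear_piola_diffeo[OF L])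
  interpret L': diffeo ?\<Omega> "(*v) L'" "(*v) L" "\<lambda>_. L'" "\<lambda>_. L"
    by (rule L.inverse_diffeo)
  have g: "has_weak_gradient ?\<Omega> w (weak_gradient ?\<Omega> w)" (is "has_weak_gradient _ _ ?g")
    by (rule has_weak_gradient_weak_gradient[OF w])
  note \<phi>C1 = C1c_imp_C1_on[OF L.open_\<Omega> \<phi>]
  have inv: "L *v (L' *v y) = y" for y
    using L by (simp add: matrix_vector_mul_assoc)
  have Q: "transpose L ** transpose L' = mat 1" "transpose L' ** transpose L = mat 1"
    using L by (simp_all add: transpose_mat flip: matrix_transpose_mul)
  have field: "finsler_field N p (transpose L *v a) = L' *v finsler_field norm p a" for a
    unfolding N finsler_field_linear[OF Q(1)]
    by (simp only: matrix_vector_mul_assoc Q matrix_vector_mul_lid transpose_transpose)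
  have "finsler_laplacian ?\<Omega> N p (\<lambda>x. w (L *v x)) \<phi>
      = - (LINT x:?\<Omega>|lebesgue. (L' *v finsler_field norm p (?g (L *v x))) \<bullet> gradient \<phi> x)"
    unfolding finsler_laplacian_eq[OF L.open_\<Omega> L.has_weak_gradient_compose[OF g]] field ..
  also have "\<dots> = - (LINT y:?\<Omega>|lebesgue. \<bar>det L'\<bar> *
      ((L' *v finsler_field norm p (?g (L *v (L' *v y)))) \<bullet> gradient \<phi> (L' *v y)))"
    by (subst L'.set_integral_transform) (rule refl)
  also have "\<dots> = - (LINT y:?\<Omega>|lebesgue. finsler_field norm p (?g y) \<bullet> gradient (\<lambda>y. \<bar>det L'\<bar> * \<phi> (L' *v y)) y)"
  proof (intro arg_cong[where f = uminus] set_integral_cong_AE_lebesgue AE_I2 impI)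
    fix y assume y: "y \<in> ?\<Omega>"
    have "gradient (\<lambda>y. \<bar>det L'\<bar> * \<phi> (L' *v y)) y = \<bar>det L'\<bar> *\<^sub>R (transpose L' *v gradient \<phi> (L' *v y))"
      by (simp only: gradient_mult[OF C1_on_const L'.C1_on_compose[OF \<phi>C1] y] L'.gradient_compose[OF \<phi>C1 y]
          gradient_const scaleR_zero_right add_0_right)
    then show "\<bar>det L'\<bar> * ((L' *v finsler_field norm p (?g (L *v (L' *v y)))) \<bullet> gradient \<phi> (L' *v y))
        = finsler_field norm p (?g y) \<bullet> gradient (\<lambda>y. \<bar>det L'\<bar> * \<phi> (L' *v y)) y"
      by (simp only: inv inner_matrix_transpose inner_scaleR_right)
  qed
  also have "\<dots> = finsler_laplacian ?\<Omega> norm p w (\<lambda>y. \<bar>det L'\<bar> * \<phi> (L' *v y))"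
    by (simp only: finsler_laplacian_eq[OF L.open_\<Omega> g])
  finally show ?thesis .
qed

section \<open>The Kelvin transform\<close>

lemma transpose_D_inversion: "transpose (D_inversion x) = D_inversion x"
  using transpose_reflection[of x] by (simp add: D_inversion_def transpose_def vec_eq_iff)

text \<open>The derivative of the inversion is conformal with factor \<open>\<bar>x\<bar>\<^sup>-\<^sup>2\<close>, and the pairing
  is homogeneous of degree \<open>p\<close> under a simultaneous scaling of \<open>a\<close> and \<open>b\<close>.\<close>
lemma finsler_field_D_inversion:
  fixes x :: "real^'n"
  assumes "x \<noteq> 0"
  shows "finsler_field norm p (D_inversion x *v a) \<bullet> (D_inversion x *v b)
    = inverse (x \<bullet> x) powr p * (finsler_field norm p a \<bullet> b)"
proof -
  have r: "0 < inverse (x \<bullet> x)" using assms by simp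
  have D: "D_inversion x *v a = inverse (x \<bullet> x) *\<^sub>R (reflection x *v a)" for a
    by (simp add: D_inversion_def scaleR_matrix_vector_assoc)
  have "norm (reflection x *v a) = norm a"
    by (simp add: norm_eq_sqrt_inner inner_reflection)
  then have n: "norm (D_inversion x *v a) = inverse (x \<bullet> x) * norm a"
    using r by (simp add: D)
  have "inverse (x \<bullet> x) powr p = inverse (x \<bullet> x) powr (p - 2) * inverse (x \<bullet> x) powr 2"
    by (simp del: powr_numeral flip: powr_add)
  also have "inverse (x \<bullet> x) powr 2 = inverse (x \<bullet> x) * inverse (x \<bullet> x)"
    using r by (simp add: power2_eq_square)
  finally show ?thesis
    using r by (simp add: finsler_field_norm n powr_mult) (simp add: D inner_reflection)
qed

text \<open>For \<open>p = n\<close> the conformal factor \<open>\<bar>x\<bar>\<^bsup>-2n\<^esup>\<close> of the integrand is precisely the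
  Jacobian of the inversion, so this is a pure change of variables.\<close>
lemma n_laplacian_inversion:
  fixes v :: "real^'n \<Rightarrow> real"
  defines "\<Omega> \<equiv> UNIV - {0}"
  assumes v: "v \<in> W1p_loc \<Omega> q" and \<phi>: "\<phi> \<in> C1c \<Omega>"
  shows "finsler_laplacian \<Omega> norm (real CARD('n)) (\<lambda>x. v (inversion x)) \<phi>
    = finsler_laplacian \<Omega> norm (real CARD('n)) v (\<lambda>y. \<phi> (inversion y))"
proof -
  interpret I: piola_diffeo \<Omega> inversion inversion D_inversion D_inversion
    unfolding \<Omega>_def by (rule inversion_piola_diffeo)
  have g: "has_weak_gradient \<Omega> v (weak_gradient \<Omega> v)" (is "has_weak_gradient _ _ ?g")
    by (rule has_weak_gradient_weak_gradient[OF v])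
  let ?n = "real CARD('n)" and ?\<psi> = "\<lambda>y. \<phi> (inversion y)"
  have \<psi>: "?\<psi> \<in> C1_on \<Omega>"
    by (intro I.C1_on_compose C1c_imp_C1_on[OF I.open_\<Omega> \<phi>])
  have "(LINT x:\<Omega>|lebesgue. finsler_field norm ?n (transpose (D_inversion x) *v ?g (inversion x)) \<bullet> gradient \<phi> x)
      = (LINT x:\<Omega>|lebesgue. \<bar>det (D_inversion x)\<bar> * (finsler_field norm ?n (?g (inversion x)) \<bullet> gradient ?\<psi> (inversion x)))"
  proof (intro set_integral_cong_AE_lebesgue AE_I2 impI)
    fix x assume x: "x \<in> \<Omega>"
    then have r: "0 < inverse (x \<bullet> x)" by (simp add: \<Omega>_def)
    have "gradient \<phi> x = gradient (\<lambda>x. ?\<psi> (inversion x)) x"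
      by (simp add: inversion_involution)
    also have "\<dots> = D_inversion x *v gradient ?\<psi> (inversion x)"
      by (simp only: I.gradient_compose[OF \<psi> x] transpose_D_inversion)
    finally show "finsler_field norm ?n (transpose (D_inversion x) *v ?g (inversion x)) \<bullet> gradient \<phi> x
        = \<bar>det (D_inversion x)\<bar> * (finsler_field norm ?n (?g (inversion x)) \<bullet> gradient ?\<psi> (inversion x))"
      using x r by (simp only: transpose_D_inversion finsler_field_D_inversion abs_det_D_inversion powr_realpow)
        (simp add: \<Omega>_def finsler_field_D_inversion powr_realpow)
  qed
  also have "\<dots> = (LINT y:\<Omega>|lebesgue. finsler_field norm ?n (?g y) \<bullet> gradient ?\<psi> y)"
    by (rule I.set_integral_transform[symmetric])
  finally show ?thesis
    by (simp only: finsler_laplacian_eq[OF I.open_\<Omega> I.has_weak_gradient_compose[OF g]]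
        finsler_laplacian_eq[OF I.open_\<Omega> g])
qed

text \<open>A multiple of the fundamental solution of the Laplace equation for \<open>n \<ge> 3\<close>. Subtraction of
  natural numbers makes it the constant \<open>1\<close> for \<open>n \<le> 2\<close>.\<close>
definition kelvin_weight :: "real^'n \<Rightarrow> real" where
  "kelvin_weight x = 1 / norm x ^ (CARD('n) - 2)"

lemma GDERIV_inverse_norm_power:
  fixes y :: "real^'n"
  assumes "y \<noteq> 0"
  shows "GDERIV (\<lambda>y. inverse (norm y) ^ m) y :> (- real m * (inverse (norm y) ^ m * inverse (y \<bullet> y))) *\<^sub>R y"
proof -
  have "DERIV (\<lambda>t. inverse t ^ m) (norm y) :> - real m * (inverse (norm y) ^ m * inverse (norm y))"
    by (rule DERIV_cong[OF DERIV_power[OF DERIV_inverse]]) (use assms in \<open>cases m; simp add: algebra_simps\<close>)+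
  from GDERIV_DERIV_compose[OF GDERIV_norm[OF assms] this]
  have "GDERIV (\<lambda>y. inverse (norm y) ^ m) y :> (- real m * (inverse (norm y) ^ m * inverse (norm y))) *\<^sub>R sgn y" .
  then show ?thesis
    by (simp add: sgn_div_norm power2_norm_eq_inner[symmetric] power2_eq_square mult.assoc)
qed

lemma kelvin_weight_eq: "kelvin_weight x = inverse (norm (x :: real^'n)) ^ (CARD('n) - 2)"
  by (simp add: kelvin_weight_def power_inverse divide_inverse)

lemma gradient_kelvin_weight:
  fixes x :: "real^'n"
  assumes "x \<noteq> 0"
  shows "gradient kelvin_weight x = (- real (CARD('n) - 2) * (kelvin_weight x * inverse (x \<bullet> x))) *\<^sub>R x"
  unfolding kelvin_weight_eq[abs_def] by (rule gradient_eqI, rule GDERIV_inverse_norm_power[OF assms])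

lemma C1_on_kelvin_weight: "(kelvin_weight :: real^'n \<Rightarrow> real) \<in> C1_on (UNIV - {0})"
proof (rule C1_onI)
  show "GDERIV kelvin_weight x :> (- real (CARD('n) - 2) * (inverse (norm x) ^ (CARD('n) - 2) * inverse (x \<bullet> x))) *\<^sub>R x"
    if "x \<in> UNIV - {0}" for x :: "real^'n"
    unfolding kelvin_weight_eq[abs_def] using that by (intro GDERIV_inverse_norm_power) simp
  show "continuous_on (UNIV - {0}) (\<lambda>x :: real^'n. (- real (CARD('n) - 2) * (inverse (norm x) ^ (CARD('n) - 2) * inverse (x \<bullet> x))) *\<^sub>R x)"
    by (intro continuous_intros) auto
qed

lemma kelvin_weight_square:
  fixes x :: "real^'n"
  shows "kelvin_weight x * kelvin_weight x = inverse (x \<bullet> x) ^ (CARD('n) - 2)"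
  by (simp add: kelvin_weight_eq power2_norm_eq_inner[symmetric] power2_eq_square power_mult_distrib power_inverse)

lemma inner_D_inversion:
  fixes x :: "real^'n"
  shows "(D_inversion x *v a) \<bullet> (D_inversion x *v b) = inverse (x \<bullet> x) ^ 2 * (a \<bullet> b)"
  by (simp add: D_inversion_def scaleR_matrix_vector_assoc[symmetric] inner_reflection power2_eq_square)

lemma finsler_field_norm_2: "finsler_field norm 2 \<xi> = \<xi>"
  by (cases "\<xi> = 0") (simp_all add: finsler_field_norm)

lemma kelvin_weight_inversion: "x \<noteq> 0 \<Longrightarrow> kelvin_weight x * kelvin_weight (inversion x) = 1"
  by (simp add: kelvin_weight_def norm_inversion power_inverse)

text \<open>The field \<open>\<beta>\<close> is \<open>k \<nabla>k\<close> for the Kelvin weight \<open>k\<close>, written without norms.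
  Its divergence is \<open>\<bar>\<nabla>k\<bar>\<^sup>2 + k \<Delta>k\<close>, so the last claim expresses that \<open>k\<close> is
  harmonic.\<close>
lemma kelvin_weight_divergence:
  fixes x :: "real^'n"
  defines "\<beta> i \<equiv> (\<lambda>x :: real^'n. - real (CARD('n) - 2) * (inverse (x \<bullet> x) ^ (CARD('n) - 1) * x $ i))"
  assumes n: "CARD('n) \<ge> 2"
  shows "\<beta> i \<in> C1_on (UNIV - {0})"
    and "x \<noteq> 0 \<Longrightarrow> \<beta> i x = kelvin_weight x * gradient kelvin_weight x $ i"
    and "x \<noteq> 0 \<Longrightarrow> (\<Sum>i\<in>UNIV. gradient (\<beta> i) x $ i) = gradient kelvin_weight x \<bullet> gradient kelvin_weight x"
proof -
  let ?r = "inverse (x \<bullet> x)" and ?n = "CARD('n)"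
  obtain m where m: "?n = m + 2"
    using n by (metis add.commute le_Suc_ex)
  show \<beta>: "\<beta> i \<in> C1_on (UNIV - {0})" for i
    unfolding \<beta>_def by (intro C1_on_mult C1_on_const C1_on_inverse_inner_power C1_on_component)
  show "\<beta> i x = kelvin_weight x * gradient kelvin_weight x $ i" if "x \<noteq> 0"
    using kelvin_weight_square[of x] that
    by (simp add: \<beta>_def gradient_kelvin_weight m)
  assume x: "x \<noteq> 0"
  have eq: "real (?n - 2) = real m" "?n - 1 = m + 1"
    by (simp_all add: m)
  have "gradient (\<beta> i) x $ i = - real m * (?r ^ (m + 1) - 2 * real (m + 1) * ?r ^ (m + 2) * (x $ i * x $ i))" for i
  proof -
    have "GDERIV (\<beta> i) x :> (- real m) *\<^sub>R (?r ^ (m + 1) *\<^sub>R axis i 1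
        + x $ i *\<^sub>R ((- 2 * real (m + 1) * ?r ^ (m + 1 + 1)) *\<^sub>R x)) + (?r ^ (m + 1) * x $ i) *\<^sub>R 0"
      unfolding \<beta>_def eq
      by (intro GDERIV_mult GDERIV_const GDERIV_inverse_inner_power x)
        (rule C1_onD[OF C1_on_component UNIV_I, unfolded gradient_component])
    then have "gradient (\<beta> i) x $ i = ((- real m) *\<^sub>R (?r ^ (m + 1) *\<^sub>R axis i 1
        + x $ i *\<^sub>R ((- 2 * real (m + 1) * ?r ^ (m + 1 + 1)) *\<^sub>R x)) + (?r ^ (m + 1) * x $ i) *\<^sub>R 0) $ i"
      by (simp only: gradient_eqI)
    then show ?thesis
      by (simp add: algebra_simps)
  qed
  then have "(\<Sum>i\<in>UNIV. gradient (\<beta> i) x $ i)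
      = - real m * (real ?n * ?r ^ (m + 1) - 2 * real (m + 1) * ?r ^ (m + 2) * (\<Sum>i\<in>UNIV. x $ i * x $ i))"
    by (simp add: sum_distrib_left sum_subtractf sum_negf right_diff_distrib mult.assoc)
  also have "(\<Sum>i\<in>UNIV. x $ i * x $ i) = x \<bullet> x"
    by (simp add: inner_vec_def)
  also have "2 * real (m + 1) * ?r ^ (m + 2) * (x \<bullet> x) = 2 * real (m + 1) * ?r ^ (m + 1)"
    using x by simp
  also have "- real m * (real ?n * ?r ^ (m + 1) - 2 * real (m + 1) * ?r ^ (m + 1)) = (real m)\<^sup>2 * ?r ^ (m + 1)"
    by (simp add: m algebra_simps power2_eq_square)
  also have "\<dots> = gradient kelvin_weight x \<bullet> gradient kelvin_weight x"
  proof -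
    have "gradient kelvin_weight x \<bullet> gradient kelvin_weight x
        = (real m)\<^sup>2 * (kelvin_weight x * kelvin_weight x) * ?r * (?r * (x \<bullet> x))"
      by (simp add: gradient_kelvin_weight[OF x] m power2_eq_square)
    then show ?thesis
      using x by (simp add: kelvin_weight_square m)
  qed
  finally show "(\<Sum>i\<in>UNIV. gradient (\<beta> i) x $ i) = gradient kelvin_weight x \<bullet> gradient kelvin_weight x" .
qed

text \<open>Write \<open>v\<^sub>0 = v \<circ> I\<close> with weak gradient \<open>g\<^sub>0\<close>, and \<open>\<phi> = k \<zeta>\<close>. Then
  \<open>\<nabla>(k v\<^sub>0) \<bullet> \<nabla>\<phi>\<close> is \<open>k\<^sup>2 g\<^sub>0 \<bullet> \<nabla>\<zeta>\<close> plus
  \<open>\<Sum>\<^sub>i (g\<^sub>0)\<^sub>i W\<^sub>i + v\<^sub>0 \<partial>\<^sub>i W\<^sub>i\<close> with \<open>W = \<zeta> k \<nabla>k\<close>; the harmonicity of \<open>k\<close> enters in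
  collecting the terms with \<open>v\<^sub>0\<close> into a divergence. The integral of the sum is zero by the
  definition of the weak gradient of \<open>v\<^sub>0\<close>, so that no second derivative of \<open>v\<close> occurs. In the
  remaining term \<open>k\<^sup>2 \<bar>x\<bar>\<^sup>-\<^sup>4 = \<bar>x\<bar>\<^bsup>-2n\<^esup>\<close> is the Jacobian of \<open>I\<close>.\<close>
lemma laplacian_kelvin:
  fixes v :: "real^'n \<Rightarrow> real"
  defines "\<Omega> \<equiv> UNIV - {0}"
  assumes n: "CARD('n) \<ge> 2" and v: "v \<in> W1p_loc \<Omega> q" and \<phi>: "\<phi> \<in> C1c \<Omega>"
  shows "finsler_laplacian \<Omega> norm 2 (\<lambda>x. kelvin_weight x * v (inversion x)) \<phi>
    = finsler_laplacian \<Omega> norm 2 v (\<lambda>y. kelvin_weight y * \<phi> (inversion y))"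
proof -
  interpret I: piola_diffeo \<Omega> inversion inversion D_inversion D_inversion
    unfolding \<Omega>_def by (rule inversion_piola_diffeo)
  note \<Omega> = I.open_\<Omega>
  let ?k = "kelvin_weight :: real^'n \<Rightarrow> real"
  have k: "?k \<in> C1_on \<Omega>"
    unfolding \<Omega>_def by (rule C1_on_kelvin_weight)
  define g where "g = weak_gradient \<Omega> v"
  have g: "has_weak_gradient \<Omega> v g"
    unfolding g_def by (rule has_weak_gradient_weak_gradient[OF v])
  define v0 where "v0 = (\<lambda>x. v (inversion x))"
  define g0 where "g0 = (\<lambda>x. transpose (D_inversion x) *v g (inversion x))"
  have g0: "has_weak_gradient \<Omega> v0 g0"
    unfolding v0_def g0_def by (rule I.has_weak_gradient_compose[OF g])
  define \<psi> where "\<psi> = (\<lambda>y. ?k y * \<phi> (inversion y))"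
  have \<psi>: "\<psi> \<in> C1c \<Omega>"
    unfolding \<psi>_def by (intro C1c_mult[OF \<Omega> k] I.C1c_compose \<phi>)
  define \<zeta> where "\<zeta> = (\<lambda>x. \<psi> (inversion x))"
  have \<zeta>: "\<zeta> \<in> C1c \<Omega>"
    unfolding \<zeta>_def by (rule I.C1c_compose[OF \<psi>])
  note \<zeta>C1 = C1c_imp_C1_on[OF \<Omega> \<zeta>] and \<psi>C1 = C1c_imp_C1_on[OF \<Omega> \<psi>]
  \<comment> \<open>At the origin the product \<open>k \<zeta>\<close> is a default value; it agrees with \<open>\<phi>\<close> because
    \<open>\<phi>\<close> vanishes there.\<close>
  have "\<phi> 0 = 0"
    using C1c_support[OF \<phi>] by (metis \<Omega>_def Diff_iff insertI1 subsetD)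
  then have "\<phi> x = ?k x * \<zeta> x" for x
    using kelvin_weight_inversion[of x]
    by (cases "x = 0") (simp_all add: \<zeta>_def \<psi>_def inversion_involution inversion_def[of 0] flip: mult.assoc)
  then have \<phi>_eq: "\<phi> = (\<lambda>x. ?k x * \<zeta> x)"
    by blast
  define \<beta> where "\<beta> i = (\<lambda>x :: real^'n. - real (CARD('n) - 2) * (inverse (x \<bullet> x) ^ (CARD('n) - 1) * x $ i))" for i
  have \<beta>: "\<beta> i \<in> C1_on \<Omega>" for i
    unfolding \<Omega>_def \<beta>_def by (rule kelvin_weight_divergence(1)[OF n])
  have \<beta>_eq: "\<beta> i x = ?k x * gradient ?k x $ i" if "x \<noteq> 0" for i x
    unfolding \<beta>_def by (rule kelvin_weight_divergence(2)[OF n that])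
  have \<beta>_div: "(\<Sum>i\<in>UNIV. gradient (\<beta> i) x $ i) = gradient ?k x \<bullet> gradient ?k x" if "x \<noteq> 0" for x
    unfolding \<beta>_def by (rule kelvin_weight_divergence(3)[OF n that])
  define W where "W i = (\<lambda>x. \<beta> i x * \<zeta> x)" for i
  have W: "W i \<in> C1c \<Omega>" for i
    unfolding W_def by (rule C1c_mult[OF \<Omega> \<beta> \<zeta>])
  have v0L: "v0 \<in> Lp_loc \<Omega> 1" and g0L: "(\<lambda>x. g0 x $ i) \<in> Lp_loc \<Omega> 1" for i
    using has_weak_gradient_Lp_loc[OF g0] by (auto intro: Lp_loc_component)
  have Ia: "set_integrable lebesgue \<Omega> (\<lambda>x. g0 x $ i * (?k x * ?k x * gradient \<zeta> x $ i))" for i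
  proof -
    obtain K where K: "compact K" "K \<subseteq> \<Omega>" "\<And>x. x \<notin> K \<Longrightarrow> gradient \<zeta> x = 0"
      using C1c_support[OF \<zeta>] by metis
    then show ?thesis
      by (intro Lp_loc_times_compact_support_integrable[OF \<Omega> g0L _ K(1,2)] continuous_intros
          C1_on_continuous[OF k] C1_on_gradient[OF \<zeta>C1]) simp
  qed
  have Ib: "set_integrable lebesgue \<Omega> (\<lambda>x. g0 x $ i * W i x)" for i
    by (rule C1c_times_integrable[OF \<Omega> g0L W])
  have Ic: "set_integrable lebesgue \<Omega> (\<lambda>x. v0 x * gradient (W i) x $ i)" for i
  proof -
    obtain K where K: "compact K" "K \<subseteq> \<Omega>" "\<And>x. x \<notin> K \<Longrightarrow> gradient (W i) x = 0"
      using C1c_support[OF W] by metis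
    then show ?thesis
      by (intro Lp_loc_times_compact_support_integrable[OF \<Omega> v0L _ K(1,2)] continuous_intros
          C1_on_gradient C1c_imp_C1_on[OF \<Omega> W]) simp
  qed
  have Ibc: "set_integrable lebesgue \<Omega> (\<lambda>x. v0 x * gradient (W i) x $ i + g0 x $ i * W i x)"
    "(LINT x:\<Omega>|lebesgue. v0 x * gradient (W i) x $ i + g0 x $ i * W i x) = 0" for i
    using set_integral_add[OF Ic Ib] has_weak_gradient_D[OF g0 W] by simp_all
  define F where "F i x = g0 x $ i * (?k x * ?k x * gradient \<zeta> x $ i) + (v0 x * gradient (W i) x $ i + g0 x $ i * W i x)" for i x
  have F: "set_integrable lebesgue \<Omega> (F i)"
    "(LINT x:\<Omega>|lebesgue. F i x) = (LINT x:\<Omega>|lebesgue. g0 x $ i * (?k x * ?k x * gradient \<zeta> x $ i))" for i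
    unfolding F_def using set_integral_add[OF Ia Ibc(1)] Ibc(2) by simp_all
  have "(LINT x:\<Omega>|lebesgue. (?k x *\<^sub>R g0 x + v0 x *\<^sub>R gradient ?k x) \<bullet> gradient \<phi> x)
      = (LINT x:\<Omega>|lebesgue. (\<Sum>i\<in>UNIV. F i x))"
  proof (intro set_integral_cong_AE_lebesgue AE_I2 impI)
    fix x assume x: "x \<in> \<Omega>"
    then have x0: "x \<noteq> 0" by (simp add: \<Omega>_def)
    have "gradient (W i) x = \<beta> i x *\<^sub>R gradient \<zeta> x + \<zeta> x *\<^sub>R gradient (\<beta> i) x" for i
      unfolding W_def by (rule gradient_mult[OF \<beta> \<zeta>C1 x])
    then have "(\<Sum>i\<in>UNIV. F i x) = (\<Sum>i\<in>UNIV. ?k x * ?k x * (g0 x $ i * gradient \<zeta> x $ i)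
        + v0 x * ?k x * (gradient ?k x $ i * gradient \<zeta> x $ i) + v0 x * \<zeta> x * gradient (\<beta> i) x $ i
        + ?k x * \<zeta> x * (g0 x $ i * gradient ?k x $ i))"
      by (intro sum.cong) (simp_all add: F_def W_def \<beta>_eq[OF x0] algebra_simps)
    also have "\<dots> = ?k x * ?k x * (g0 x \<bullet> gradient \<zeta> x) + v0 x * ?k x * (gradient ?k x \<bullet> gradient \<zeta> x)
        + v0 x * \<zeta> x * (gradient ?k x \<bullet> gradient ?k x) + ?k x * \<zeta> x * (g0 x \<bullet> gradient ?k x)"
      unfolding \<beta>_div[OF x0, symmetric] by (simp add: sum.distrib sum_distrib_left inner_vec_def)
    also have "\<dots> = (?k x *\<^sub>R g0 x + v0 x *\<^sub>R gradient ?k x) \<bullet> (?k x *\<^sub>R gradient \<zeta> x + \<zeta> x *\<^sub>R gradient ?k x)"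
      by (simp add: inner_simps algebra_simps)
    also have "?k x *\<^sub>R gradient \<zeta> x + \<zeta> x *\<^sub>R gradient ?k x = gradient \<phi> x"
      unfolding \<phi>_eq by (rule gradient_mult[OF k \<zeta>C1 x, symmetric])
    finally show "(?k x *\<^sub>R g0 x + v0 x *\<^sub>R gradient ?k x) \<bullet> gradient \<phi> x = (\<Sum>i\<in>UNIV. F i x)"
      by simp
  qed
  also have "\<dots> = (\<Sum>i\<in>UNIV. (LINT x:\<Omega>|lebesgue. g0 x $ i * (?k x * ?k x * gradient \<zeta> x $ i)))"
    by (simp add: set_integral_sum_real[OF F(1)] F(2))
  also have "\<dots> = (LINT x:\<Omega>|lebesgue. (\<Sum>i\<in>UNIV. g0 x $ i * (?k x * ?k x * gradient \<zeta> x $ i)))"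
    by (rule set_integral_sum_real[OF Ia, symmetric])
  also have "\<dots> = (LINT x:\<Omega>|lebesgue. \<bar>det (D_inversion x)\<bar> * (g (inversion x) \<bullet> gradient \<psi> (inversion x)))"
  proof (intro set_integral_cong_AE_lebesgue AE_I2 impI)
    fix x assume x: "x \<in> \<Omega>"
    obtain m where m: "CARD('n) = m + 2"
      using n by (metis add.commute le_Suc_ex)
    have "gradient \<zeta> x = D_inversion x *v gradient \<psi> (inversion x)"
      unfolding \<zeta>_def by (simp only: I.gradient_compose[OF \<psi>C1 x] transpose_D_inversion)
    then have "g0 x \<bullet> gradient \<zeta> x = inverse (x \<bullet> x) ^ 2 * (g (inversion x) \<bullet> gradient \<psi> (inversion x))"
      by (simp only: g0_def transpose_D_inversion inner_D_inversion)
    moreover have "(\<Sum>i\<in>UNIV. g0 x $ i * (?k x * ?k x * gradient \<zeta> x $ i)) = ?k x * ?k x * (g0 x \<bullet> gradient \<zeta> x)"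
      by (simp add: inner_vec_def sum_distrib_left mult_ac)
    ultimately show "(\<Sum>i\<in>UNIV. g0 x $ i * (?k x * ?k x * gradient \<zeta> x $ i))
        = \<bar>det (D_inversion x)\<bar> * (g (inversion x) \<bullet> gradient \<psi> (inversion x))"
      by (simp only: kelvin_weight_square abs_det_D_inversion m power_add add_diff_cancel_right' mult.assoc)
  qed
  also have "\<dots> = (LINT y:\<Omega>|lebesgue. g y \<bullet> gradient \<psi> y)"
    by (rule I.set_integral_transform[symmetric])
  finally have "finsler_laplacian \<Omega> norm 2 (\<lambda>x. ?k x * v0 x) \<phi> = finsler_laplacian \<Omega> norm 2 v \<psi>"
    by (simp only: finsler_laplacian_eq[OF \<Omega> has_weak_gradient_mult[OF \<Omega> k g0]]
        finsler_laplacian_eq[OF \<Omega> g] finsler_field_norm_2)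
  then show ?thesis
    by (simp only: v0_def \<psi>_def)
qed

section \<open>Reduction to the Euclidean norm\<close>

text \<open>Substituting \<open>\<zeta> = B \<xi>\<close> turns the supremum into that of \<open>z \<bullet> \<zeta>\<close> over the open Euclidean
  unit ball with \<open>z\<close> the transpose of \<open>B\<^sup>-\<^sup>1\<close> applied to \<open>x\<close>; it is approached along the direction
  of \<open>z\<close> but not attained unless \<open>z = 0\<close>.\<close>
lemma dual_norm_linear:
  fixes B B' :: "real^'n^'n"
  assumes B: "B ** B' = mat 1" "B' ** B = mat 1"
  shows "dual_norm (\<lambda>\<xi>. norm (B *v \<xi>)) x = norm (transpose B' *v x)"
proof -
  let ?z = "transpose B' *v x"
  have inv: "B *v (B' *v y) = y" "B' *v (B *v y) = y" for y
    using B by (simp_all add: matrix_vector_mul_assoc)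
  have move: "x \<bullet> (B' *v \<zeta>) = ?z \<bullet> \<zeta>" for \<zeta>
    using inner_matrix_transpose[of B' \<zeta> x] by (simp only: inner_commute)
  have "(\<lambda>\<xi>. x \<bullet> \<xi>) ` {\<xi>. norm (B *v \<xi>) < 1} = (\<lambda>\<zeta>. ?z \<bullet> \<zeta>) ` {\<zeta>. norm \<zeta> < 1}"
  proof (intro equalityI subsetI)
    fix t assume "t \<in> (\<lambda>\<xi>. x \<bullet> \<xi>) ` {\<xi>. norm (B *v \<xi>) < 1}"
    then obtain \<xi> where "t = x \<bullet> \<xi>" "norm (B *v \<xi>) < 1" by blast
    then show "t \<in> (\<lambda>\<zeta>. ?z \<bullet> \<zeta>) ` {\<zeta>. norm \<zeta> < 1}"
      using move[of "B *v \<xi>"] by (intro image_eqI[of _ _ "B *v \<xi>"]) (simp_all only: inv mem_Collect_eq)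
  next
    fix t assume "t \<in> (\<lambda>\<zeta>. ?z \<bullet> \<zeta>) ` {\<zeta>. norm \<zeta> < 1}"
    then obtain \<zeta> where "t = ?z \<bullet> \<zeta>" "norm \<zeta> < 1" by blast
    then show "t \<in> (\<lambda>\<xi>. x \<bullet> \<xi>) ` {\<xi>. norm (B *v \<xi>) < 1}"
      by (intro image_eqI[of _ _ "B' *v \<zeta>"]) (simp_all only: move inv mem_Collect_eq)
  qed
  moreover have "Sup ((\<lambda>\<zeta>. ?z \<bullet> \<zeta>) ` {\<zeta>. norm \<zeta> < 1}) = norm ?z"
  proof (rule cSup_eq_non_empty)
    have "0 \<in> {\<zeta> :: real^'n. norm \<zeta> < 1}" by simp
    then show "(\<lambda>\<zeta>. ?z \<bullet> \<zeta>) ` {\<zeta>. norm \<zeta> < 1} \<noteq> {}" by blast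
    fix t assume "t \<in> (\<lambda>\<zeta>. ?z \<bullet> \<zeta>) ` {\<zeta>. norm \<zeta> < 1}"
    then obtain \<zeta> where \<zeta>: "t = ?z \<bullet> \<zeta>" "norm \<zeta> < 1" by blast
    have "t \<le> norm ?z * norm \<zeta>"
      unfolding \<zeta>(1) by (rule norm_cauchy_schwarz)
    also have "\<dots> \<le> norm ?z * 1"
      using \<zeta>(2) by (intro mult_left_mono) simp_all
    finally show "t \<le> norm ?z" by simp
  next
    fix t assume t: "\<And>s. s \<in> (\<lambda>\<zeta>. ?z \<bullet> \<zeta>) ` {\<zeta>. norm \<zeta> < 1} \<Longrightarrow> s \<le> t"
    show "norm ?z \<le> t"
    proof (rule field_le_mult_one_interval)
      fix c :: real assume c: "0 < c" "c < 1"
      have "norm (c *\<^sub>R sgn ?z) < 1"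
        using c by (simp add: norm_sgn)
      then have "?z \<bullet> (c *\<^sub>R sgn ?z) \<le> t"
        by (intro t) blast
      moreover have "?z \<bullet> (c *\<^sub>R sgn ?z) = c * norm ?z"
        by (cases "?z = 0") (simp_all add: sgn_div_norm power2_norm_eq_inner[symmetric] power2_eq_square)
      ultimately show "c * norm ?z \<le> t" by metis
    qed
  qed
  ultimately show ?thesis
    by (simp add: dual_norm_def)
qed

lemma gradient_div_norm_linear:
  fixes B B' :: "real^'n^'n"
  assumes "B' ** B = mat 1"
  shows "gradient (\<lambda>\<xi>. norm (B *v \<xi>)) \<xi> /\<^sub>R norm (B *v \<xi>) = transpose B *v inversion (B *v \<xi>)"
proof (cases "\<xi> = 0")
  case True
  then show ?thesis by (simp add: inversion_def)
next
  case False
  then show ?thesis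
    by (simp only: gradient_norm_linear[OF assms False] matrix_vector_mult_scaleR[symmetric])
      (simp add: sgn_div_norm inversion_def power2_norm_eq_inner[symmetric] power2_eq_square del: transpose_matrix_vector)
qed

text \<open>The two parts of the theorem differ only in the exponent \<open>p\<close>, the weight \<open>k\<close> and the power
  \<open>m\<close> of \<open>H\<close>. For the test function \<open>\<phi>\<close>, the right-hand functional evaluates \<open>\<Delta>\<^sup>H\<^sub>p u\<close>
  at \<open>\<psi>\<close>, whose weight is the product of the Jacobian \<open>(det B)\<^sup>-\<^sup>2 \<bar>z\<bar>\<^bsup>-2n\<^esup>\<close> of the inverse
  of \<open>T\<close> and the factor \<open>\<bar>z\<bar>\<^sup>m\<close> coming from \<open>H\<^bsup>-m\<^esup>\<close>, where \<open>z = B\<^sup>-\<^sup>1 y\<close>. The hypothesis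
  \<open>weight\<close> says that apart from the determinant this product is \<open>k z\<close>, the weight in the
  Euclidean identity.\<close>
lemma kelvin_identity_transfer:
  fixes B B' :: "real^'n^'n" and k :: "real^'n \<Rightarrow> real"
  defines "\<Omega> \<equiv> UNIV - {0 :: real^'n}"
  assumes B: "B ** B' = mat 1" "B' ** B = mat 1" and sym: "transpose B = B" "transpose B' = B'"
    and H: "H = (\<lambda>\<xi>. norm (B *v \<xi>))" and T: "T = (\<lambda>\<xi>. B *v inversion (B *v \<xi>))"
    and k: "k \<in> C1_on \<Omega>"
    and weight: "\<And>z. z \<noteq> 0 \<Longrightarrow> inverse (z \<bullet> z) ^ CARD('n) * norm z ^ m = k z"
    and kelvin: "\<And>v \<phi>. v \<in> W1p_loc \<Omega> p \<Longrightarrow> \<phi> \<in> C1c \<Omega> \<Longrightarrow>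
      finsler_laplacian \<Omega> norm p (\<lambda>x. k x * v (inversion x)) \<phi>
        = finsler_laplacian \<Omega> norm p v (\<lambda>y. k y * \<phi> (inversion y))"
    and p: "0 \<le> p" and u: "u \<in> W1p_loc \<Omega> p"
    and U: "U = (\<lambda>x. k (B *v x) * u (T x))"
  shows "U \<in> W1p_loc \<Omega> p"
    and "(\<lambda>\<eta>. U (B' *v \<eta>)) \<in> W1p_loc \<Omega> p"
    and "eq_on_tests \<Omega> (finsler_laplacian \<Omega> (dual_norm H) p U)
      (fun_comp \<Omega> (finsler_laplacian \<Omega> norm p (\<lambda>\<eta>. U (B' *v \<eta>))) (\<lambda>x. B *v x))"
    and "eq_on_tests \<Omega>
      (fun_comp \<Omega> (finsler_laplacian \<Omega> norm p (\<lambda>\<eta>. U (B' *v \<eta>))) (\<lambda>x. B *v x))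
      (fun_times (\<lambda>x. 1 / H x ^ m) (fun_comp \<Omega> (finsler_laplacian \<Omega> H p u) T))"
proof -
  interpret B: piola_diffeo \<Omega> "(*v) B" "(*v) B'" "\<lambda>_. B" "\<lambda>_. B'"
    unfolding \<Omega>_def by (rule linear_piola_diffeo[OF B])
  interpret B': piola_diffeo \<Omega> "(*v) B'" "(*v) B" "\<lambda>_. B'" "\<lambda>_. B"
    unfolding \<Omega>_def by (rule linear_piola_diffeo[OF B(2,1)])
  interpret I: piola_diffeo \<Omega> inversion inversion D_inversion D_inversion
    unfolding \<Omega>_def by (rule inversion_piola_diffeo)
  interpret T: diffeo \<Omega> "\<lambda>x. B *v inversion (B *v x)" "\<lambda>y. B' *v inversion (B' *v y)"
    "\<lambda>x. B ** (D_inversion (B *v x) ** B)" "\<lambda>y. (B' ** D_inversion (B' *v y)) ** B'"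
    by (rule diffeo_compose[OF diffeo_compose[OF B.diffeo_axioms I.diffeo_axioms] B.diffeo_axioms])
  note \<Omega> = I.open_\<Omega>
  have inv: "B *v (B' *v y) = y" "B' *v (B *v y) = y" for y
    using B by (simp_all add: matrix_vector_mul_assoc)
  have det: "\<bar>det B\<bar> * \<bar>det B'\<bar> = 1"
    using B(1) by (metis abs_mult abs_one det_I det_mul)
  define v where "v = (\<lambda>y. u (B *v y))"
  define w where "w = (\<lambda>\<eta>. k \<eta> * v (inversion \<eta>))"
  have v: "v \<in> W1p_loc \<Omega> p"
    unfolding v_def by (rule B.W1p_loc_compose[OF u p])
  have w: "w \<in> W1p_loc \<Omega> p"
    unfolding w_def by (intro W1p_loc_mult[OF \<Omega> k _ p] I.W1p_loc_compose v p)
  have Uw: "U = (\<lambda>x. w (B *v x))"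
    by (simp add: U w_def v_def T)
  have UB': "(\<lambda>\<eta>. U (B' *v \<eta>)) = w"
    by (simp add: Uw inv)
  show "U \<in> W1p_loc \<Omega> p"
    unfolding Uw by (rule B.W1p_loc_compose[OF w p])
  show "(\<lambda>\<eta>. U (B' *v \<eta>)) \<in> W1p_loc \<Omega> p"
    unfolding UB' by (rule w)
  have test_0: "\<phi> x = 0" if "\<phi> \<in> C1c \<Omega>" "x \<notin> \<Omega>" for \<phi> x
    using C1c_support[OF that(1)] that(2) by (metis subsetD)
  have middle: "fun_comp \<Omega> (finsler_laplacian \<Omega> norm p w) (\<lambda>x. B *v x) \<phi>
      = finsler_laplacian \<Omega> norm p w (\<lambda>y. \<bar>det B'\<bar> * \<phi> (B' *v y))" if "\<phi> \<in> C1c \<Omega>" for \<phi>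
    by (rule B.fun_comp_eq) (rule test_0[OF that])
  have dual: "dual_norm H = (\<lambda>\<xi>. norm (transpose B' *v \<xi>))"
    unfolding H using dual_norm_linear[OF B] by blast
  show "eq_on_tests \<Omega> (finsler_laplacian \<Omega> (dual_norm H) p U)
      (fun_comp \<Omega> (finsler_laplacian \<Omega> norm p (\<lambda>\<eta>. U (B' *v \<eta>))) (\<lambda>x. B *v x))"
    unfolding eq_on_tests_def UB'
  proof
    fix \<phi> assume \<phi>: "\<phi> \<in> C1c \<Omega>"
    show "finsler_laplacian \<Omega> (dual_norm H) p U \<phi>
        = fun_comp \<Omega> (finsler_laplacian \<Omega> norm p w) (\<lambda>x. B *v x) \<phi>"
      unfolding middle[OF \<phi>] Uw using w \<phi> unfolding \<Omega>_def
      by (rule finsler_laplacian_linear[OF B _ _ dual])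
  qed
  show "eq_on_tests \<Omega>
      (fun_comp \<Omega> (finsler_laplacian \<Omega> norm p (\<lambda>\<eta>. U (B' *v \<eta>))) (\<lambda>x. B *v x))
      (fun_times (\<lambda>x. 1 / H x ^ m) (fun_comp \<Omega> (finsler_laplacian \<Omega> H p u) T))"
    unfolding eq_on_tests_def UB'
  proof
    fix \<phi> assume \<phi>: "\<phi> \<in> C1c \<Omega>"
    define \<phi>1 where "\<phi>1 = (\<lambda>y. \<bar>det B'\<bar> * \<phi> (B' *v y))"
    have \<phi>1: "\<phi>1 \<in> C1c \<Omega>"
      unfolding \<phi>1_def by (intro C1c_mult[OF \<Omega> C1_on_const] B'.C1c_compose \<phi>)
    define \<psi> where "\<psi> = (\<lambda>y. \<bar>det B'\<bar> * (k (B' *v y) * \<phi>1 (inversion (B' *v y))))"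
    have "(\<lambda>z. k z * \<phi>1 (inversion z)) \<in> C1c \<Omega>"
      by (intro C1c_mult[OF \<Omega> k] I.C1c_compose \<phi>1)
    from B'.C1c_compose[OF this] have \<psi>: "\<psi> \<in> C1c \<Omega>"
      unfolding \<psi>_def by (rule C1c_mult[OF \<Omega> C1_on_const])
    have "fun_times (\<lambda>x. 1 / H x ^ m) (fun_comp \<Omega> (finsler_laplacian \<Omega> H p u) T) \<phi>
        = finsler_laplacian \<Omega> H p u (\<lambda>y. \<bar>det ((B' ** D_inversion (B' *v y)) ** B')\<bar> *
            (1 / H (B' *v inversion (B' *v y)) ^ m * \<phi> (B' *v inversion (B' *v y))))"
      unfolding fun_times_def T by (rule T.fun_comp_eq) (simp add: test_0[OF \<phi>])
    also have "(\<lambda>y. \<bar>det ((B' ** D_inversion (B' *v y)) ** B')\<bar> *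
            (1 / H (B' *v inversion (B' *v y)) ^ m * \<phi> (B' *v inversion (B' *v y)))) = \<psi>"
    proof
      fix y
      show "\<bar>det ((B' ** D_inversion (B' *v y)) ** B')\<bar> *
            (1 / H (B' *v inversion (B' *v y)) ^ m * \<phi> (B' *v inversion (B' *v y))) = \<psi> y"
      proof (cases "y \<in> \<Omega>")
        case True
        then have z: "B' *v y \<noteq> 0"
          using B'.\<Phi>_in_iff by (simp add: \<Omega>_def)
        show ?thesis
          unfolding \<psi>_def \<phi>1_def weight[OF z, symmetric]
          by (simp add: det_mul abs_mult abs_det_D_inversion H inv norm_inversion power_inverse divide_inverse mult_ac)
      next
        case False
        then have "\<phi> (B' *v inversion (B' *v y)) = 0"
          using T.\<Psi>_in_iff by (intro test_0[OF \<phi>]) simp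
        then show ?thesis
          by (simp add: \<psi>_def \<phi>1_def)
      qed
    qed
    also have "finsler_laplacian \<Omega> H p u \<psi> = finsler_laplacian \<Omega> H p (\<lambda>x. v (B' *v x)) \<psi>"
      by (simp add: v_def inv)
    also have "\<dots> = finsler_laplacian \<Omega> norm p v (\<lambda>z. \<bar>det B\<bar> * \<psi> (B *v z))"
      using v \<psi> unfolding \<Omega>_def
      by (rule finsler_laplacian_linear[OF B(2,1)]) (simp only: H sym)
    also have "(\<lambda>z. \<bar>det B\<bar> * \<psi> (B *v z)) = (\<lambda>z. k z * \<phi>1 (inversion z))"
      unfolding \<psi>_def inv mult.assoc[symmetric] det by simp
    also have "finsler_laplacian \<Omega> norm p v (\<lambda>z. k z * \<phi>1 (inversion z)) = finsler_laplacian \<Omega> norm p w \<phi>1"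
      unfolding w_def by (rule kelvin[OF v \<phi>1, symmetric])
    finally show "fun_comp \<Omega> (finsler_laplacian \<Omega> norm p w) (\<lambda>x. B *v x) \<phi>
        = fun_times (\<lambda>x. 1 / H x ^ m) (fun_comp \<Omega> (finsler_laplacian \<Omega> H p u) T) \<phi>"
      unfolding middle[OF \<phi>] \<phi>1_def by simp
  qed
qed

lemma sym_pos_def_inverse:
  fixes B :: "real^'n^'n"
  assumes "sym_pos_def B"
  shows "transpose B = B" "B ** matrix_inv B = mat 1" "matrix_inv B ** B = mat 1"
    "transpose (matrix_inv B) = matrix_inv B"
proof -
  show sym: "transpose B = B"
    using assms by (simp add: sym_pos_def_def)
  have "x = 0" if "B *v x = 0" for x
    using assms that unfolding sym_pos_def_def by (metis inner_zero_left less_irrefl)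
  then have "invertible B"
    by (simp add: invertible_left_inverse matrix_left_invertible_ker)
  then show B: "B ** matrix_inv B = mat 1" "matrix_inv B ** B = mat 1"
    using someI_ex[of "\<lambda>A. B ** A = mat 1 \<and> A ** B = mat 1"]
    unfolding invertible_def matrix_inv_def by blast+
  have "transpose (matrix_inv B) = (transpose (matrix_inv B) ** transpose B) ** matrix_inv B"
    using B(1) by (simp add: sym matrix_mul_assoc[symmetric])
  also have "\<dots> = matrix_inv B"
    using B(1) by (simp add: transpose_mat flip: matrix_transpose_mul)
  finally show "transpose (matrix_inv B) = matrix_inv B" .
qed

theorem theorem1p2:
  fixes M B :: "real^'n^'n" and H :: "real^'n \<Rightarrow> real" and T :: "real^'n \<Rightarrow> real^'n"
    and \<Omega> :: "(real^'n) set"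
  assumes n: "CARD('n) \<ge> 2"
    and M: "sym_pos_def M"
    and H: "H = (\<lambda>\<xi>. sqrt ((M *v \<xi>) \<bullet> \<xi>))"
    and B: "sym_pos_def B" "B ** B = M"
    and \<Omega>: "\<Omega> = UNIV - {0}"
    and T: "T = (\<lambda>\<xi>. gradient H \<xi> /\<^sub>R H \<xi>)"
  shows
    "(\<forall>u \<in> W1p_loc \<Omega> 2. \<forall>u_hat. u_hat = (\<lambda>x. u (T x) / H x ^ (CARD('n) - 2)) \<longrightarrow>
        u_hat \<in> W1p_loc \<Omega> 2 \<and>
        (\<lambda>\<eta>. u_hat (matrix_inv B *v \<eta>)) \<in> W1p_loc \<Omega> 2 \<and>
        eq_on_tests \<Omega> (finsler_laplacian \<Omega> (dual_norm H) 2 u_hat)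
          (fun_comp \<Omega> (finsler_laplacian \<Omega> norm 2 (\<lambda>\<eta>. u_hat (matrix_inv B *v \<eta>))) (\<lambda>x. B *v x)) \<and>
        eq_on_tests \<Omega>
          (fun_comp \<Omega> (finsler_laplacian \<Omega> norm 2 (\<lambda>\<eta>. u_hat (matrix_inv B *v \<eta>))) (\<lambda>x. B *v x))
          (fun_times (\<lambda>x. 1 / H x ^ (CARD('n) + 2))
            (fun_comp \<Omega> (finsler_laplacian \<Omega> H 2 u) T)))
     \<and>
     (\<forall>u \<in> W1p_loc \<Omega> (real CARD('n)). \<forall>u_star. u_star = (\<lambda>x. u (T x)) \<longrightarrow>
        u_star \<in> W1p_loc \<Omega> (real CARD('n)) \<and>
        (\<lambda>\<eta>. u_star (matrix_inv B *v \<eta>)) \<in> W1p_loc \<Omega> (real CARD('n)) \<and>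
        eq_on_tests \<Omega> (finsler_laplacian \<Omega> (dual_norm H) (real CARD('n)) u_star)
          (fun_comp \<Omega> (finsler_laplacian \<Omega> norm (real CARD('n)) (\<lambda>\<eta>. u_star (matrix_inv B *v \<eta>)))
            (\<lambda>x. B *v x)) \<and>
        eq_on_tests \<Omega>
          (fun_comp \<Omega> (finsler_laplacian \<Omega> norm (real CARD('n)) (\<lambda>\<eta>. u_star (matrix_inv B *v \<eta>)))
            (\<lambda>x. B *v x))
          (fun_times (\<lambda>x. 1 / H x ^ (2 * CARD('n)))
            (fun_comp \<Omega> (finsler_laplacian \<Omega> H (real CARD('n)) u) T)))"
proof -
  have pos: "real CARD('n) \<ge> 0" by simp
  note inv = sym_pos_def_inverse[OF B(1)]
  have H_eq: "H = (\<lambda>\<xi>. norm (B *v \<xi>))"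
  proof
    fix \<xi>
    have "(M *v \<xi>) \<bullet> \<xi> = (B *v (B *v \<xi>)) \<bullet> \<xi>"
      by (simp only: matrix_vector_mul_assoc B(2))
    also have "\<dots> = (B *v \<xi>) \<bullet> (B *v \<xi>)"
      by (simp only: inner_matrix_transpose inv(1))
    finally show "H \<xi> = norm (B *v \<xi>)"
      by (simp add: H norm_eq_sqrt_inner)
  qed
  have T_eq: "T = (\<lambda>\<xi>. B *v inversion (B *v \<xi>))"
    unfolding T H_eq by (simp only: gradient_div_norm_linear[OF inv(3)] inv(1))
  note transfer = kelvin_identity_transfer[OF inv(2,3,1,4) H_eq T_eq, folded \<Omega>]
  show ?thesis
  proof (intro conjI ballI allI impI)
    fix u u_hat assume u: "u \<in> W1p_loc \<Omega> 2" and u_hat: "u_hat = (\<lambda>x. u (T x) / H x ^ (CARD('n) - 2))"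
    have U: "u_hat = (\<lambda>x. kelvin_weight (B *v x) * u (T x))"
      by (simp add: u_hat H_eq kelvin_weight_def)
    have k: "kelvin_weight \<in> C1_on \<Omega>"
      unfolding \<Omega> by (rule C1_on_kelvin_weight)
    obtain m where m: "CARD('n) = m + 2"
      using n by (metis add.commute le_Suc_ex)
    have weight: "inverse (z \<bullet> z) ^ CARD('n) * norm z ^ (CARD('n) + 2) = kelvin_weight z"
      if "z \<noteq> 0" for z :: "real^'n"
    proof -
      have "(z \<bullet> z) ^ (m + 2) = norm z ^ (m + (m + 2 + 2))"
        unfolding power2_norm_eq_inner[symmetric] power_mult[symmetric]
        by (rule arg_cong[where f = "power (norm z)"]) simp
      then have "(z \<bullet> z) ^ CARD('n) = norm z ^ m * norm z ^ (CARD('n) + 2)"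
        unfolding m power_add[of _ m "m + 2 + 2"] .
      then have "inverse (z \<bullet> z) ^ CARD('n) * norm z ^ (CARD('n) + 2)
          = norm z ^ (CARD('n) + 2) / (norm z ^ m * norm z ^ (CARD('n) + 2))"
        by (simp only: power_inverse divide_inverse mult.commute)
      also have "\<dots> = 1 / norm z ^ m"
        using that by simp
      finally show ?thesis
        by (simp only: kelvin_weight_def m add_diff_cancel_right')
    qed
    have kelvin: "finsler_laplacian \<Omega> norm 2 (\<lambda>x. kelvin_weight x * v (inversion x)) \<phi>
        = finsler_laplacian \<Omega> norm 2 v (\<lambda>y. kelvin_weight y * \<phi> (inversion y))"
      if "v \<in> W1p_loc \<Omega> 2" "\<phi> \<in> C1c \<Omega>" for v \<phi>
      using that unfolding \<Omega> by (rule laplacian_kelvin[OF n])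
    note thms = transfer[OF k weight kelvin _ u U]
    show "u_hat \<in> W1p_loc \<Omega> 2" by (rule thms(1)) simp_all
    show "(\<lambda>\<eta>. u_hat (matrix_inv B *v \<eta>)) \<in> W1p_loc \<Omega> 2" by (rule thms(2)) simp_all
    show "eq_on_tests \<Omega> (finsler_laplacian \<Omega> (dual_norm H) 2 u_hat)
          (fun_comp \<Omega> (finsler_laplacian \<Omega> norm 2 (\<lambda>\<eta>. u_hat (matrix_inv B *v \<eta>))) (\<lambda>x. B *v x))"
      by (rule thms(3)) simp_all
    show "eq_on_tests \<Omega>
          (fun_comp \<Omega> (finsler_laplacian \<Omega> norm 2 (\<lambda>\<eta>. u_hat (matrix_inv B *v \<eta>))) (\<lambda>x. B *v x))
          (fun_times (\<lambda>x. 1 / H x ^ (CARD('n) + 2))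
            (fun_comp \<Omega> (finsler_laplacian \<Omega> H 2 u) T))"
      by (rule thms(4)) simp_all
  next
    fix u u_star assume u: "u \<in> W1p_loc \<Omega> (real CARD('n))" and u_star: "u_star = (\<lambda>x. u (T x))"
    have U: "u_star = (\<lambda>x. 1 * u (T x))"
      by (simp add: u_star)
    have weight: "inverse (z \<bullet> z) ^ CARD('n) * norm z ^ (2 * CARD('n)) = 1" if "z \<noteq> 0" for z :: "real^'n"
      using that by (simp add: power2_norm_eq_inner[symmetric] power_mult power_inverse)
    have kelvin: "finsler_laplacian \<Omega> norm (real CARD('n)) (\<lambda>x. 1 * v (inversion x)) \<phi>
        = finsler_laplacian \<Omega> norm (real CARD('n)) v (\<lambda>y. 1 * \<phi> (inversion y))"
      if "v \<in> W1p_loc \<Omega> (real CARD('n))" "\<phi> \<in> C1c \<Omega>" for v \<phi>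
      using that unfolding \<Omega> mult_1_left by (rule n_laplacian_inversion)
    note thms = transfer[OF C1_on_const weight kelvin pos u U]
    show "u_star \<in> W1p_loc \<Omega> (real CARD('n))" by (rule thms(1))
    show "(\<lambda>\<eta>. u_star (matrix_inv B *v \<eta>)) \<in> W1p_loc \<Omega> (real CARD('n))" by (rule thms(2))
    show "eq_on_tests \<Omega> (finsler_laplacian \<Omega> (dual_norm H) (real CARD('n)) u_star)
          (fun_comp \<Omega> (finsler_laplacian \<Omega> norm (real CARD('n)) (\<lambda>\<eta>. u_star (matrix_inv B *v \<eta>)))
            (\<lambda>x. B *v x))"
      by (rule thms(3))
    show "eq_on_tests \<Omega>
          (fun_comp \<Omega> (finsler_laplacian \<Omega> norm (real CARD('n)) (\<lambda>\<eta>. u_star (matrix_inv B *v \<eta>)))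
            (\<lambda>x. B *v x))
          (fun_times (\<lambda>x. 1 / H x ^ (2 * CARD('n)))
            (fun_comp \<Omega> (finsler_laplacian \<Omega> H (real CARD('n)) u) T))"
      by (rule thms(4))
  qed
qed

end
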